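(* Let $d_A,d_B\in\mathbb{N}$, let $P:\mathcal{M}_{d_A}\to\mathcal{M}_{d_B}$ be a non-zero positive map, set $d:=\min(d_A,d_B)$, and let $n\in\mathbb{N}$ with $n\geq 2$. If $P^{\otimes n}$ is decomposable, then $$\max\big(\mu(P),\,\mu(\vartheta_{d_B}\circ P)\big)\ \geq\ \frac{2}{1+\Big(1+\sqrt{\tfrac{2d}{d+1}}\Big)^{1/\lfloor n/2\rfloor}}-1 .$$
   Context: $\mathcal{M}_d$ denotes the complex $d\times d$ matrices; $\vartheta_d$ is the transposition on $\mathcal{M}_d$ in the computational basis; $\mathbb{1}_d$ is the identity matrix. A linear map is positive if it maps positive semidefinite matrices to positive semidefinite matrices. A linear map $L:\mathcal{M}_{d_A}\to\mathcal{M}_{d_B}$ is decomposable if $L=T_1+\vartheta_{d_B}\circ T_2$ with $T_1,T_2:\mathcal{M}_{d_A}\to\mathcal{M}_{d_B}$ completely positive; $P^{\otimes n}$ is regarded as a map $\mathcal{M}_{d_A^n}\to\mathcal{M}_{d_B^n}$. The Choi matrix of a linear map $L:\mathcal{M}_{d_A}\to\mathcal{M}_{d_B}$ is $C_L=(\mathrm{id}_{d_A}\otimes L)(\omega_{d_A})$, where $\omega_{d}=\sum_{i,j=1}^{d}|i\rangle\langle j|\otimes|i\rangle\langle j|$. For a non-zero positive map $P:\mathcal{M}_{d_A}\to\mathcal{M}_{d_B}$, $$\mu(P):=\inf\Big\{\frac{\mathrm{Tr}[C_PC_T]}{\mathrm{Tr}[(T^*\circ P)(\mathbb{1}_{d_A})]}\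 \Big|\ T:\mathcal{M}_{d_A}\to\mathcal{M}_{d_B}\text{ completely positive},\ (T^*\circ P)(\mathbb{1}_{d_A})\neq 0\Big\},$$ where $T^*$ is the adjoint of $T$ with respect to the Hilbert–Schmidt inner product $\langle A,B\rangle=\mathrm{Tr}[A^\dagger B]$. $\lfloor x\rfloor$ is the largest integer less than or equal to $x$. *)

theory Defs
  imports "HOL-Analysis.Analysis"
begin

text \<open>
  \<open>d \<times> d\<close> complex matrices are \<open>complex^'a^'a\<close> with \<open>CARD('a) = d\<close>; the elements of \<open>'a\<close> label
  the computational basis, so \<open>\<vartheta>\<close> is the library's \<^const>\<open>transpose\<close>, and tensor products of matrix
  algebras are matrices over product index types: \<open>'a \<times> 'b\<close> for \<open>d\<^sub>A d\<^sub>B\<close>, and \<open>'n \<Rightarrow> 'a\<close> for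
  \<open>d\<^sub>A ^ n\<close> where \<open>CARD('n) = n\<close>.
\<close>

definition mat_scale :: "complex \<Rightarrow> complex^'a^'b \<Rightarrow> complex^'a^'b" where
  "mat_scale c A = (\<chi> i j. c * A $ i $ j)"

abbreviation clinear_map :: "(complex^'a^'a \<Rightarrow> complex^'b^'b) \<Rightarrow> bool" where
  "clinear_map L \<equiv> Vector_Spaces.linear mat_scale mat_scale L"

definition mat_unit :: "'a \<Rightarrow> 'b \<Rightarrow> complex^'b^'a" where
  "mat_unit i j = (\<chi> k l. if k = i \<and> l = j then 1 else 0)"

definition dagger :: "complex^'a^'b \<Rightarrow> complex^'b^'a" where
  "dagger A = (\<chi> i j. cnj (A $ j $ i))"

definition hs_inner :: "complex^'a^'a::finite \<Rightarrow> complex^'a^'a \<Rightarrow> complex" where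
  "hs_inner A B = trace (dagger A ** B)"

definition hs_adjoint ::
    "(complex^'a^'a::finite \<Rightarrow> complex^'b^'b::finite) \<Rightarrow> complex^'b^'b \<Rightarrow> complex^'a^'a" where
  "hs_adjoint T = (THE S. \<forall>X Y. hs_inner (T X) Y = hs_inner X (S Y))"


section \<open>Positivity\<close>

text \<open>
  Positive semidefiniteness of the matrix \<open>M\<close> with rows and columns indexed by the finite set \<open>I\<close>.
  Over the complex numbers, a real non-negative quadratic form forces \<open>M\<close> to be Hermitian.
\<close>
definition psd_on :: "'i set \<Rightarrow> ('i \<Rightarrow> 'i \<Rightarrow> complex) \<Rightarrow> bool" where
  "psd_on I M \<longleftrightarrow> (\<forall>v. (\<Sum>i\<in>I. \<Sum>j\<in>I. cnj (v i) * M i j * v j) \<in> \<real>\<^sub>\<ge>\<^sub>0)"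

definition psd :: "complex^'a^'a::finite \<Rightarrow> bool" where
  "psd A \<longleftrightarrow> psd_on UNIV (\<lambda>i j. A $ i $ j)"

definition positive_map :: "(complex^'a^'a::finite \<Rightarrow> complex^'b^'b::finite) \<Rightarrow> bool" where
  "positive_map L \<longleftrightarrow> clinear_map L \<and> (\<forall>X. psd X \<longrightarrow> psd (L X))"

text \<open>
  An element of \<open>\<M>\<^sub>k \<otimes> \<M>\<^sub>d\<close> is a \<open>k \<times> k\<close> block matrix \<open>(X p q)\<close>, \<open>p, q < k\<close>, of \<open>d \<times> d\<close>
  matrices, and \<open>id\<^sub>k \<otimes> T\<close> applies \<open>T\<close> to each block.  Blocks are indexed by natural numbers
  because \<open>k\<close> is quantified inside the definition of complete positivity.
\<close>
definition block_psd :: "nat \<Rightarrow> (nat \<Rightarrow> nat \<Rightarrow> complex^'a^'a::finite) \<Rightarrow> bool" where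
  "block_psd k X \<longleftrightarrow> psd_on ({..<k} \<times> UNIV) (\<lambda>(p, i) (q, j). X p q $ i $ j)"

definition completely_positive :: "(complex^'a^'a::finite \<Rightarrow> complex^'b^'b::finite) \<Rightarrow> bool" where
  "completely_positive T \<longleftrightarrow>
     clinear_map T \<and> (\<forall>k X. block_psd k X \<longrightarrow> block_psd k (\<lambda>p q. T (X p q)))"

definition decomposable :: "(complex^'a^'a::finite \<Rightarrow> complex^'b^'b::finite) \<Rightarrow> bool" where
  "decomposable L \<longleftrightarrow>
     (\<exists>T1 T2. completely_positive T1 \<and> completely_positive T2 \<and>
        L = (\<lambda>X. T1 X + (transpose \<circ> T2) X))"


section \<open>Tensor products and the Choi matrix\<close>

definition kron :: "complex^'a^'a::finite \<Rightarrow> complex^'b^'b::finite \<Rightarrow> complex^('a \<times> 'b)^('a \<times> 'b)" where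
  "kron A B = (\<chi> p q. A $ fst p $ fst q * B $ snd p $ snd q)"

text \<open>\<open>id \<otimes> L\<close>, applied blockwise; see \<open>id_tensor_kron\<close>.\<close>
definition id_tensor ::
    "(complex^'a^'a::finite \<Rightarrow> complex^'b^'b::finite) \<Rightarrow>
     complex^('k::finite \<times> 'a)^('k \<times> 'a) \<Rightarrow> complex^('k \<times> 'b)^('k \<times> 'b)" where
  "id_tensor L X = (\<chi> p q. L (\<chi> i j. X $ (fst p, i) $ (fst q, j)) $ snd p $ snd q)"

definition max_ent :: "complex^('a::finite \<times> 'a)^('a \<times> 'a)" where
  "max_ent = (\<Sum>i\<in>UNIV. \<Sum>j\<in>UNIV. kron (mat_unit i j) (mat_unit i j))"

definition choi :: "(complex^'a^'a::finite \<Rightarrow> complex^'b^'b::finite) \<Rightarrow> complex^('a \<times> 'b)^('a \<times> 'b)" where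
  "choi L = id_tensor L max_ent"

definition tensor_prod :: "('n::finite \<Rightarrow> complex^'a^'a::finite) \<Rightarrow> complex^('n \<Rightarrow> 'a)^('n \<Rightarrow> 'a)" where
  "tensor_prod X = (\<chi> a b. \<Prod>k\<in>UNIV. X k $ a k $ b k)"

text \<open>
  The tensor power \<open>P\<^bsup>\<otimes>n\<^esup>\<close>: the linear extension of
  \<open>\<Otimes>\<^sub>k |i\<^sub>k\<rangle>\<langle>j\<^sub>k| \<mapsto> \<Otimes>\<^sub>k P(|i\<^sub>k\<rangle>\<langle>j\<^sub>k|)\<close>; see \<open>tensor_power_tensor_prod\<close>.
\<close>
definition tensor_power ::
    "(complex^'a^'a::finite \<Rightarrow> complex^'b^'b::finite) \<Rightarrow>
     complex^('n::finite \<Rightarrow> 'a)^('n \<Rightarrow> 'a) \<Rightarrow> complex^('n \<Rightarrow> 'b)^('n \<Rightarrow> 'b)" where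
  "tensor_power P X =
     (\<Sum>i\<in>UNIV. \<Sum>j\<in>UNIV. mat_scale (X $ i $ j) (tensor_prod (\<lambda>k. P (mat_unit (i k) (j k)))))"


section \<open>The quantity mu\<close>

text \<open>
  For positive \<open>P\<close> and completely positive \<open>T\<close> both traces are real, and the quotients are at
  least \<open>-1\<close>; for non-zero \<open>P\<close> the set is non-empty.  So the real infimum is the intended one.
\<close>
definition mu :: "(complex^'a^'a::finite \<Rightarrow> complex^'b^'b::finite) \<Rightarrow> real" where
  "mu P = Inf {Re (trace (choi P ** choi T)) / Re (trace ((hs_adjoint T \<circ> P) (mat 1))) | T.
                 completely_positive T \<and> (hs_adjoint T \<circ> P) (mat 1) \<noteq> 0}"


section \<open>Characteristic properties of the definitions\<close>

lemma vector_space_mat_scale: "vector_space (mat_scale :: complex \<Rightarrow> complex^'a^'b \<Rightarrow> _)"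
  by unfold_locales (auto simp: mat_scale_def vec_eq_iff algebra_simps)

lemma clinear_map_iff:
  "clinear_map L \<longleftrightarrow>
     (\<forall>X Y. L (X + Y) = L X + L Y) \<and> (\<forall>c X. L (mat_scale c X) = mat_scale c (L X))"
  by (auto simp: Vector_Spaces.linear_def module_hom_def module_hom_axioms_def
      vector_space_mat_scale module_iff_vector_space)

lemma sum_mat_unit:
  fixes f :: "'a::finite \<Rightarrow> 'b::finite \<Rightarrow> complex"
  shows "(\<Sum>i\<in>UNIV. \<Sum>j\<in>UNIV. f i j * mat_unit i j $ k $ l) = f k l"
proof -
  have "(\<Sum>j\<in>UNIV. f i j * mat_unit i j $ k $ l) = (if i = k then f i l else 0)" for i
    by (cases "i = k") (simp_all add: mat_unit_def if_distrib[of "\<lambda>x. _ * x"] cong: if_cong)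
  then show ?thesis by simp
qed

lemma clinear_map_expand:
  assumes "clinear_map L"
  shows "L X = (\<Sum>i\<in>UNIV. \<Sum>j\<in>UNIV. mat_scale (X $ i $ j) (L (mat_unit i j)))"
proof -
  have eq: "X = (\<Sum>i\<in>UNIV. \<Sum>j\<in>UNIV. mat_scale (X $ i $ j) (mat_unit i j))"
    by (simp add: vec_eq_iff mat_scale_def sum_mat_unit)
  interpret L: Vector_Spaces.linear mat_scale mat_scale L by fact
  show ?thesis
    by (subst eq) (simp add: L.sum L.scale)
qed

lemma id_tensor_kron:
  assumes "clinear_map L"
  shows "id_tensor L (kron A B) = kron A (L B)"
proof -
  have "(\<chi> i j. kron A B $ (p, i) $ (q, j)) = mat_scale (A $ p $ q) B" for p q
    by (simp add: kron_def mat_scale_def)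
  then show ?thesis
    using assms by (simp add: id_tensor_def clinear_map_iff) (simp add: kron_def mat_scale_def)
qed

lemma tensor_power_tensor_prod:
  assumes "clinear_map P"
  shows "tensor_power P (tensor_prod X) = tensor_prod (\<lambda>k. P (X k))"
proof -
  have swap: "(\<Prod>k\<in>UNIV. \<Sum>i\<in>UNIV. f k i) = (\<Sum>g\<in>UNIV. \<Prod>k\<in>UNIV. f k (g k))"
    for f :: "'n::finite \<Rightarrow> 'i::finite \<Rightarrow> complex"
    using prod_sum_PiE[of "UNIV :: 'n set" "\<lambda>_. UNIV" f] by simp
  have "P (X k) $ a $ b =
      (\<Sum>i\<in>UNIV. \<Sum>j\<in>UNIV. X k $ i $ j * P (mat_unit i j) $ a $ b)" for k a b
    by (subst clinear_map_expand[OF assms]) (simp add: mat_scale_def)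
  then show ?thesis
    by (simp add: vec_eq_iff tensor_power_def tensor_prod_def mat_scale_def swap prod.distrib)
qed

lemma hs_inner_eq: "hs_inner A B = (\<Sum>i\<in>UNIV. \<Sum>j\<in>UNIV. cnj (A $ i $ j) * B $ i $ j)"
  unfolding hs_inner_def trace_def dagger_def matrix_matrix_mult_def
  by simp (rule sum.swap)

lemma hs_inner_mat_unit: "hs_inner (mat_unit i j) B = B $ i $ j"
proof -
  have "cnj (mat_unit i j $ k $ l) * B $ k $ l = B $ k $ l * mat_unit k l $ i $ j" for k l
    by (auto simp: mat_unit_def)
  then show ?thesis by (simp only: hs_inner_eq sum_mat_unit)
qed

lemma sum_swap4:
  "(\<Sum>a\<in>A. \<Sum>b\<in>B. \<Sum>i\<in>I. \<Sum>j\<in>J. f a b i j) = (\<Sum>i\<in>I. \<Sum>j\<in>J. \<Sum>a\<in>A. \<Sum>b\<in>B. f a b i j)"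
proof -
  have "(\<Sum>a\<in>A. \<Sum>b\<in>B. \<Sum>i\<in>I. \<Sum>j\<in>J. f a b i j) = (\<Sum>a\<in>A. \<Sum>i\<in>I. \<Sum>b\<in>B. \<Sum>j\<in>J. f a b i j)"
    by (intro sum.cong refl sum.swap)
  also have "\<dots> = (\<Sum>i\<in>I. \<Sum>a\<in>A. \<Sum>b\<in>B. \<Sum>j\<in>J. f a b i j)"
    by (rule sum.swap)
  also have "\<dots> = (\<Sum>i\<in>I. \<Sum>a\<in>A. \<Sum>j\<in>J. \<Sum>b\<in>B. f a b i j)"
    by (intro sum.cong refl sum.swap)
  also have "\<dots> = (\<Sum>i\<in>I. \<Sum>j\<in>J. \<Sum>a\<in>A. \<Sum>b\<in>B. f a b i j)"
    by (intro sum.cong refl sum.swap)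
  finally show ?thesis .
qed

lemma hs_adjoint_works:
  assumes "clinear_map T"
  shows "hs_inner (T X) Y = hs_inner X (hs_adjoint T Y)"
proof -
  define S where "S = (\<lambda>Y. \<chi> i j. hs_inner (T (mat_unit i j)) Y)"
  have S: "hs_inner (T X) Y = hs_inner X (S Y)" for X Y
  proof -
    have "hs_inner (T X) Y = (\<Sum>a\<in>UNIV. \<Sum>b\<in>UNIV. \<Sum>i\<in>UNIV. \<Sum>j\<in>UNIV.
        cnj (X $ i $ j) * (cnj (T (mat_unit i j) $ a $ b) * Y $ a $ b))"
      by (subst clinear_map_expand[OF assms])
        (simp add: hs_inner_eq mat_scale_def sum_distrib_right mult.assoc)
    also have "\<dots> = (\<Sum>i\<in>UNIV. \<Sum>j\<in>UNIV. \<Sum>a\<in>UNIV. \<Sum>b\<in>UNIV.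
        cnj (X $ i $ j) * (cnj (T (mat_unit i j) $ a $ b) * Y $ a $ b))"
      by (rule sum_swap4)
    also have "\<dots> = hs_inner X (S Y)"
      by (simp add: hs_inner_eq S_def sum_distrib_left)
    finally show ?thesis .
  qed
  have unique: "R = S" if R: "\<forall>X Y. hs_inner (T X) Y = hs_inner X (R Y)" for R
  proof (rule ext)
    fix Y
    have "R Y $ i $ j = S Y $ i $ j" for i j
      using R S[of "mat_unit i j" Y] by (simp add: hs_inner_mat_unit)
    then show "R Y = S Y" by (simp add: vec_eq_iff)
  qed
  have "hs_adjoint T = S"
    unfolding hs_adjoint_def using S unique by (intro the_equality) blast+
  then show ?thesis using S by simp
qed

end

(*
  If L is decomposable and W and its partial transpose are both positive semidefinite, then
  Tr[C_L W] is non-negative.  For L = P^{\<otimes>n} and negative mu(P), mu(theta P), such a W with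
  Tr[C_L W] < 0 is built from m = floor(n/2) sites carrying images X0 of 1 and X1 of omega under the
  local completely positive maps that nearly attain mu(P), and m sites carrying the partial
  transposes Y0, Y1 of the corresponding kernels for theta P.  With u, v the products over the m
  sites of X0 - X1 and X0 + X1, and u', v' those of Y0 - Y1 and Y0 + Y1,
    W = v u' + u v' - u u' + (d-1)/(d+1) v v',
  which is positive because 0 <= omega <= d and -1 <= F <= 1 for the flip F, the partial transpose
  of omega; the partial transpose of W has the same form with the two groups of sites exchanged.
  Denoting by U, V, U', V' the values of C_P on the four products, Tr[C_L W] is a positive multiple of
    2d/(d+1) V V' - (U - V)(U' - V'),
  which is negative once U > (1 + sqrt(2d/(d+1))) V and U' > (1 + sqrt(2d/(d+1))) V'.  Here V and V'
  are non-negative because X0 + X1 is itself an admissible test at a single site.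
*)
theory Submission
  imports Defs
begin

section \<open>Positive semidefinite kernels\<close>

lemma mult_cnj_cmod: "z * cnj z = (complex_of_real (cmod z))\<^sup>2"
  by (metis complex_norm_square of_real_power)

lemma psd_on_add: "psd_on I K \<Longrightarrow> psd_on I M \<Longrightarrow> psd_on I (\<lambda>i j. K i j + M i j)"
  by (auto simp: psd_on_def algebra_simps sum.distrib)

lemma psd_on_sum:
  assumes "\<And>k. k \<in> S \<Longrightarrow> psd_on I (K k)"
  shows "psd_on I (\<lambda>i j. \<Sum>k\<in>S. K k i j)"
  using assms
proof (induction S rule: infinite_finite_induct)
  case (insert x S)
  then show ?case using psd_on_add[of I "K x" "\<lambda>i j. \<Sum>k\<in>S. K k i j"] by simp
qed (auto simp: psd_on_def)

lemma psd_on_scale: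
  assumes "psd_on I K" "0 \<le> c"
  shows "psd_on I (\<lambda>i j. complex_of_real c * K i j)"
  unfolding psd_on_def
proof
  fix v
  have "(\<Sum>i\<in>I. \<Sum>j\<in>I. cnj (v i) * (complex_of_real c * K i j) * v j) =
      complex_of_real c * (\<Sum>i\<in>I. \<Sum>j\<in>I. cnj (v i) * K i j * v j)"
    by (simp add: sum_distrib_left algebra_simps)
  then show "(\<Sum>i\<in>I. \<Sum>j\<in>I. cnj (v i) * (complex_of_real c * K i j) * v j) \<in> \<real>\<^sub>\<ge>\<^sub>0"
    using assms by (simp add: psd_on_def)
qed

lemma quadratic_form_rank_one:
  fixes x v :: "'i \<Rightarrow> complex"
  shows "(\<Sum>i\<in>I. \<Sum>j\<in>I. cnj (v i) * (cnj (x i) * x j) * v j) =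
    complex_of_real ((cmod (\<Sum>j\<in>I. x j * v j))\<^sup>2)"
proof -
  have "(\<Sum>i\<in>I. \<Sum>j\<in>I. cnj (v i) * (cnj (x i) * x j) * v j) =
      cnj (\<Sum>j\<in>I. x j * v j) * (\<Sum>j\<in>I. x j * v j)"
    unfolding cnj_sum sum_product by (intro sum.cong refl) simp
  then show ?thesis by (simp only: complex_norm_square mult.commute)
qed

lemma psd_on_rank_one: "psd_on I (\<lambda>i j. cnj (x i) * x j)"
  by (simp add: psd_on_def quadratic_form_rank_one)

lemma psd_on_diag_scale:
  assumes "psd_on I K"
  shows "psd_on I (\<lambda>i j. cnj (x i) * x j * K i j)"
  unfolding psd_on_def
proof
  fix v
  show "(\<Sum>i\<in>I. \<Sum>j\<in>I. cnj (v i) * (cnj (x i) * x j * K i j) * v j) \<in> \<real>\<^sub>\<ge>\<^sub>0"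
    using assms[unfolded psd_on_def, rule_format, of "\<lambda>i. x i * v i"]
    by (simp add: algebra_simps)
qed

text \<open>The quadratic form at \<open>v\<close> is that of \<open>K\<close> at the fibre sums
  \<open>v'\<close>. As \<open>h\<close> may identify indices, this covers restrictions, reindexings
  and kernels depending on one coordinate only.\<close>

lemma psd_on_pullback:
  fixes h :: "'i \<Rightarrow> 'j"
  assumes "psd_on J K" "finite I" "finite J" "h ` I \<subseteq> J"
  shows "psd_on I (\<lambda>i j. K (h i) (h j))"
  unfolding psd_on_def
proof
  fix v :: "'i \<Rightarrow> complex"
  define v' where "v' k = (\<Sum>i\<in>{i\<in>I. h i = k}. v i)" for k
  have lin: "(\<Sum>i\<in>I. g (h i) * v i) = (\<Sum>k\<in>J. g k * v' k)" for g :: "'j \<Rightarrow> complex"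
    by (subst sum.group[OF assms(2,3,4), symmetric])
      (auto simp: v'_def sum_distrib_left intro!: sum.cong)
  have cnjlin: "(\<Sum>i\<in>I. cnj (v i) * g (h i)) = (\<Sum>k\<in>J. cnj (v' k) * g k)" for g :: "'j \<Rightarrow> complex"
    using arg_cong[OF lin[of "\<lambda>k. cnj (g k)"], of cnj] by (simp add: mult.commute)
  have "(\<Sum>i\<in>I. \<Sum>j\<in>I. cnj (v i) * K (h i) (h j) * v j)
      = (\<Sum>i\<in>I. cnj (v i) * (\<Sum>l\<in>J. K (h i) l * v' l))"
    by (simp add: sum_distrib_left mult.assoc flip: lin)
  also have "\<dots> = (\<Sum>k\<in>J. cnj (v' k) * (\<Sum>l\<in>J. K k l * v' l))"
    by (rule cnjlin)
  also have "\<dots> = (\<Sum>k\<in>J. \<Sum>l\<in>J. cnj (v' k) * K k l * v' l)"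
    by (simp add: sum_distrib_left mult.assoc)
  finally show "(\<Sum>i\<in>I. \<Sum>j\<in>I. cnj (v i) * K (h i) (h j) * v j) \<in> \<real>\<^sub>\<ge>\<^sub>0"
    using assms(1) by (simp add: psd_on_def)
qed

lemma psd_on_two:
  assumes "psd_on I K" "finite I" "i \<in> I" "j \<in> I"
  shows "cnj s * K i i * s + cnj s * K i j * t + cnj t * K j i * s + cnj t * K j j * t \<in> \<real>\<^sub>\<ge>\<^sub>0"
proof -
  let ?f = "case_bool i j"
  have "psd_on UNIV (\<lambda>x y. K (?f x) (?f y))"
    by (rule psd_on_pullback[OF assms(1)]) (use assms in \<open>auto split: bool.split\<close>)
  from this[unfolded psd_on_def, rule_format, of "case_bool s t"]
  show ?thesis by (simp add: UNIV_bool algebra_simps)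
qed

lemma psd_on_diag: "psd_on I K \<Longrightarrow> finite I \<Longrightarrow> i \<in> I \<Longrightarrow> K i i \<in> \<real>\<^sub>\<ge>\<^sub>0"
  using psd_on_two[of I K i i 1 0] by simp

text \<open>Reality of the form at the test vectors (1, 1) and (1, \<i>) on the indices
  \<open>i\<close>, \<open>j\<close> compares the imaginary and the real parts,
  respectively.\<close>

lemma psd_on_hermitian:
  assumes "psd_on I K" "finite I" "i \<in> I" "j \<in> I"
  shows "K j i = cnj (K i j)"
proof (rule complex_eqI)
  note diag = psd_on_diag[OF assms(1,2,3)] psd_on_diag[OF assms(1,2,4)]
  show "Im (K j i) = Im (cnj (K i j))"
    using psd_on_two[OF assms, of 1 1] diag by (simp add: complex_nonneg_Reals_iff)
  show "Re (K j i) = Re (cnj (K i j))"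
    using psd_on_two[OF assms, of 1 \<i>] diag by (simp add: complex_nonneg_Reals_iff)
qed

lemma psd_on_zero_diag:
  assumes "psd_on I K" "finite I" "i \<in> I" "j \<in> I" "K i i = 0"
  shows "K i j = 0" "K j i = 0"
proof -
  \<comment> \<open>The test vector (\<open>?t\<close>, 1) makes the form affine in
    \<open>s\<close>, because its quadratic term carries the factor \<open>K i i = 0\<close>. An
    affine function bounded below must have slope zero.\<close>
  have bound: "2 * s * (cmod (K i j))\<^sup>2 \<le> Re (K j j)" for s :: real
  proof -
    let ?t = "- complex_of_real s * K i j"
    have "cnj ?t * K i j = - complex_of_real (s * (cmod (K i j))\<^sup>2)"
      by (simp add: mult_cnj_cmod mult.commute)
    moreover have "K j i * ?t = - complex_of_real (s * (cmod (K i j))\<^sup>2)"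
      by (simp add: psd_on_hermitian[OF assms(1-4)] mult_cnj_cmod mult.commute)
    moreover have "cnj ?t * K i j + K j i * ?t + K j j \<in> \<real>\<^sub>\<ge>\<^sub>0"
      using psd_on_two[OF assms(1-4), of ?t 1] assms(5) by simp
    ultimately have "- complex_of_real (s * (cmod (K i j))\<^sup>2) +
        - complex_of_real (s * (cmod (K i j))\<^sup>2) + K j j \<in> \<real>\<^sub>\<ge>\<^sub>0"
      by metis
    then show ?thesis by (simp add: complex_nonneg_Reals_iff)
  qed
  show "K i j = 0"
  proof (rule ccontr)
    assume "K i j \<noteq> 0"
    then show False
      \<comment> \<open>For this \<open>s\<close> the bound reads
        \<open>Re (K j j) + 1 \<le> Re (K j j)\<close>.\<close>
      using bound[of "(Re (K j j) + 1) / (2 * (cmod (K i j))\<^sup>2)"] by simp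
  qed
  then show "K j i = 0"
    by (simp add: psd_on_hermitian[OF assms(1-4)])
qed

text \<open>Cholesky decomposition; \<open>M\<close> below is the Schur complement of the pivot \<open>K a a\<close>.\<close>
lemma psd_on_decompose:
  assumes "finite I" "psd_on I K"
  shows "\<exists>x. \<forall>i\<in>I. \<forall>j\<in>I. K i j = (\<Sum>k\<in>I. cnj (x k i) * x k j)"
  using assms
proof (induction I arbitrary: K rule: finite_induct)
  case (insert a I)
  note fin = \<open>finite I\<close> and psd = \<open>psd_on (insert a I) K\<close>
  have herm: "K i a = cnj (K a i)" if "i \<in> I" for i
    using psd_on_hermitian[OF psd] that fin by blast
  define \<rho> where "\<rho> = Re (K a a)"
  have Kaa: "K a a = complex_of_real \<rho>" and \<rho>: "0 \<le> \<rho>"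
    using psd_on_diag[OF psd, of a] fin by (auto simp: \<rho>_def complex_nonneg_Reals_iff complex_eq_iff)
  have zero: "K a j = 0" "K j a = 0" if "\<rho> = 0" "j \<in> insert a I" for j
    using psd_on_zero_diag[OF psd, of a j] that fin Kaa by auto
  define M where "M i j = K i j - K i a * K a j / complex_of_real \<rho>" for i j
  have "psd_on I M"
    unfolding psd_on_def
  proof
    fix v
    \<comment> \<open>Completing the square: this entry at \<open>a\<close> minimises the form when
      \<rho> > 0. When \<rho> = 0, division by zero makes the entry 0 and \<open>M\<close> equal to
      \<open>K\<close>.\<close>
    define v' where "v' = v(a := - (\<Sum>j\<in>I. K a j * v j) / complex_of_real \<rho>)"
    define t where "t = (\<Sum>j\<in>I. K a j * v j)"
    have v': "v' a = - t / complex_of_real \<rho>" "\<And>i. i \<in> I \<Longrightarrow> v' i = v i"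
      using insert.hyps by (auto simp: v'_def t_def)
    have sums: "(\<Sum>j\<in>I. K a j * v' j) = t" "(\<Sum>j\<in>I. cnj (v' j) * K j a) = cnj t"
      using v' herm by (auto simp: t_def mult.commute intro!: sum.cong)
    have "(\<Sum>i\<in>insert a I. \<Sum>j\<in>insert a I. cnj (v' i) * K i j * v' j) =
        cnj (v' a) * K a a * v' a + cnj (v' a) * (\<Sum>j\<in>I. K a j * v' j)
        + (\<Sum>j\<in>I. cnj (v' j) * K j a) * v' a + (\<Sum>i\<in>I. \<Sum>j\<in>I. cnj (v' i) * K i j * v' j)"
      using insert.hyps by (simp add: sum.distrib sum_distrib_left sum_distrib_right mult.assoc)
    also have "\<dots> = (\<Sum>i\<in>I. \<Sum>j\<in>I. cnj (v i) * K i j * v j) - cnj t * t / complex_of_real \<rho>"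
      unfolding sums by (cases "\<rho> = 0") (simp_all add: v' Kaa field_simps)
    also have "cnj t * t = (\<Sum>i\<in>I. \<Sum>j\<in>I. cnj (v i) * (K i a * K a j) * v j)"
      using herm by (simp add: t_def sum_product mult.assoc mult.left_commute)
    also have "(\<Sum>i\<in>I. \<Sum>j\<in>I. cnj (v i) * K i j * v j) - \<dots> / complex_of_real \<rho> =
        (\<Sum>i\<in>I. \<Sum>j\<in>I. cnj (v i) * M i j * v j)"
      by (simp add: M_def sum_divide_distrib algebra_simps sum_subtractf)
    finally have "(\<Sum>i\<in>I. \<Sum>j\<in>I. cnj (v i) * M i j * v j) =
        (\<Sum>i\<in>insert a I. \<Sum>j\<in>insert a I. cnj (v' i) * K i j * v' j)" ..
    moreover have "\<dots> \<in> \<real>\<^sub>\<ge>\<^sub>0"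
      using psd unfolding psd_on_def by blast
    ultimately show "(\<Sum>i\<in>I. \<Sum>j\<in>I. cnj (v i) * M i j * v j) \<in> \<real>\<^sub>\<ge>\<^sub>0"
      by argo
  qed
  from insert.IH[OF this] obtain x
    where x: "\<And>i j. i \<in> I \<Longrightarrow> j \<in> I \<Longrightarrow> M i j = (\<Sum>k\<in>I. cnj (x k i) * x k j)" by blast
  \<comment> \<open>Row \<open>a\<close> yields the rank-one kernel subtracted in \<open>M\<close>;
    the other rows are the factors of \<open>M\<close>, extended by 0 at \<open>a\<close>. When
    \<rho> = 0, row \<open>a\<close> is 0, in agreement with \<open>zero\<close>.\<close>
  define y where "y k j = (if k = a then K a j / complex_of_real (sqrt \<rho>)
    else if j = a then 0 else x k j)" for k j
  have ya: "cnj (y a i) * y a j = K i a * K a j / complex_of_real \<rho>"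
    if "i \<in> insert a I" "j \<in> insert a I" for i j
  proof -
    have "complex_of_real (sqrt \<rho>) * complex_of_real (sqrt \<rho>) = complex_of_real \<rho>"
      using \<rho> by (simp flip: of_real_mult)
    then show ?thesis using herm[of i] that Kaa by (auto simp: y_def)
  qed
  have "K i j = (\<Sum>k\<in>insert a I. cnj (y k i) * y k j)"
    if ij: "i \<in> insert a I" "j \<in> insert a I" for i j
  proof -
    have "(\<Sum>k\<in>I. cnj (y k i) * y k j) =
        (if i = a \<or> j = a then 0 else \<Sum>k\<in>I. cnj (x k i) * x k j)"
      using insert.hyps by (auto simp: y_def intro!: sum.neutral sum.cong)
    also have "\<dots> = K i j - K i a * K a j / complex_of_real \<rho>"
      using ij x[of i j] zero Kaa by (cases "\<rho> = 0") (auto simp: M_def)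
    finally show ?thesis
      using insert.hyps ya[OF ij] by simp
  qed
  then show ?case by blast
qed simp

text \<open>Schur product theorem: a rank-one summand of \<open>M\<close> acts on \<open>K\<close>
  by entrywise multiplication as a diagonal congruence.\<close>

lemma psd_on_mult:
  assumes "finite I" "psd_on I K" "psd_on I M"
  shows "psd_on I (\<lambda>i j. K i j * M i j)"
proof -
  obtain x where x: "\<And>i j. i \<in> I \<Longrightarrow> j \<in> I \<Longrightarrow> M i j = (\<Sum>k\<in>I. cnj (x k i) * x k j)"
    using psd_on_decompose[OF assms(1,3)] by blast
  have "psd_on I (\<lambda>i j. \<Sum>k\<in>I. cnj (x k i) * x k j * K i j)"
    by (intro psd_on_sum psd_on_diag_scale assms)
  then show ?thesis
    unfolding psd_on_def by (simp add: x sum_distrib_right sum_distrib_left mult_ac cong: sum.cong)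
qed

lemma psd_on_prod:
  fixes K :: "'k \<Rightarrow> 'i \<Rightarrow> 'i \<Rightarrow> complex"
  assumes "finite I" "\<And>k. k \<in> S \<Longrightarrow> psd_on I (K k)"
  shows "psd_on I (\<lambda>i j. \<Prod>k\<in>S. K k i j)"
  using assms(2)
proof (induction S rule: infinite_finite_induct)
  case (insert x S)
  then show ?case using psd_on_mult[OF assms(1), of "K x" "\<lambda>i j. \<Prod>k\<in>S. K k i j"] by simp
qed (use psd_on_rank_one[of I "\<lambda>_. 1"] in simp_all)

section \<open>The bilinear pairing Tr[K W^T]\<close>

definition pairing :: "('i \<Rightarrow> 'i \<Rightarrow> complex) \<Rightarrow> ('i \<Rightarrow> 'i \<Rightarrow> complex) \<Rightarrow> complex" where
  "pairing K W = (\<Sum>p\<in>UNIV. \<Sum>q\<in>UNIV. K p q * W p q)"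

text \<open>The pairing is the quadratic form of the entrywise product at the all-ones
  vector.\<close>

lemma pairing_psd:
  fixes K W :: "'i::finite \<Rightarrow> 'i \<Rightarrow> complex"
  assumes "psd_on UNIV K" "psd_on UNIV W"
  shows "pairing K W \<in> \<real>\<^sub>\<ge>\<^sub>0"
  using psd_on_mult[OF _ assms, unfolded psd_on_def, rule_format, of "\<lambda>_. 1"]
  by (simp add: pairing_def)

lemma pairing_add: "pairing K (\<lambda>p q. W p q + W' p q) = pairing K W + pairing K W'"
  by (simp add: pairing_def algebra_simps sum.distrib)

lemma pairing_diff: "pairing K (\<lambda>p q. W p q - W' p q) = pairing K W - pairing K W'"
  by (simp add: pairing_def algebra_simps sum_subtractf)

lemma pairing_scale: "pairing K (\<lambda>p q. c * W p q) = c * pairing K W"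
  by (simp add: pairing_def algebra_simps sum_distrib_left)

lemma pairing_add_left: "pairing (\<lambda>p q. K p q + K' p q) W = pairing K W + pairing K' W"
  by (simp add: pairing_def algebra_simps sum.distrib)

lemma pairing_tensor:
  fixes K W :: "'n::finite \<Rightarrow> 'i::finite \<Rightarrow> 'i \<Rightarrow> complex"
  shows "pairing (\<lambda>p q. \<Prod>k\<in>UNIV. K k (p k) (q k)) (\<lambda>p q. \<Prod>k\<in>UNIV. W k (p k) (q k)) =
    (\<Prod>k\<in>UNIV. pairing (K k) (W k))"
proof -
  have swap: "(\<Prod>k\<in>UNIV. \<Sum>i\<in>UNIV. f k i) = (\<Sum>g\<in>UNIV. \<Prod>k\<in>UNIV. f k (g k))"
    for f :: "'n \<Rightarrow> 'i \<Rightarrow> complex"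
    using prod_sum_PiE[of "UNIV :: 'n set" "\<lambda>_. UNIV" f] by simp
  show ?thesis
    by (simp add: pairing_def swap prod.distrib)
qed

lemma sum_UNIV_prod:
  "(\<Sum>p\<in>(UNIV :: ('a::finite \<times> 'b::finite) set). f p) = (\<Sum>a\<in>UNIV. \<Sum>b\<in>UNIV. f (a, b))"
  by (simp add: sum.cartesian_product)

text \<open>A zero form is in particular non-negative, so the basis vectors kill the diagonal and
  \<open>psd_on_zero_diag\<close> does the rest. This replaces polarisation.\<close>

lemma quadratic_form_zero:
  fixes K :: "'i::finite \<Rightarrow> 'i \<Rightarrow> complex"
  assumes "\<And>v. (\<Sum>i\<in>UNIV. \<Sum>j\<in>UNIV. cnj (v i) * K i j * v j) = 0"
  shows "K i j = 0"
proof -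
  have psd: "psd_on UNIV K"
    by (simp add: psd_on_def assms)
  have "(\<Sum>k\<in>UNIV. \<Sum>l\<in>UNIV. cnj (if k = i then 1 else 0) * K k l * (if l = i then 1 else 0)) = K i i"
    by (simp add: if_distrib[of cnj] if_distrib[of "\<lambda>x. x * _"] if_distrib[of "\<lambda>x. _ * x"] cong: if_cong)
  then have "K i i = 0"
    using assms[of "\<lambda>k. if k = i then 1 else 0"] by simp
  then show ?thesis
    using psd_on_zero_diag[OF psd, of i j] by simp
qed

section \<open>Choi kernels and partial transposes\<close>

definition choi_kernel ::
    "(complex^'a^'a::finite \<Rightarrow> complex^'b^'b::finite) \<Rightarrow> 'a \<times> 'b \<Rightarrow> 'a \<times> 'b \<Rightarrow> complex" where
  "choi_kernel L p q = L (mat_unit (fst p) (fst q)) $ snd p $ snd q"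

definition partial_transpose :: "('a \<times> 'b \<Rightarrow> 'a \<times> 'b \<Rightarrow> complex) \<Rightarrow> 'a \<times> 'b \<Rightarrow> 'a \<times> 'b \<Rightarrow> complex" where
  "partial_transpose K p q = K (fst p, snd q) (fst q, snd p)"

lemma partial_transpose_involution [simp]: "partial_transpose (partial_transpose K) = K"
  by (simp add: partial_transpose_def fun_eq_iff)

lemma choi_nth: "choi L $ p $ q = choi_kernel L p q"
proof -
  have "max_ent $ (k, i) $ (l, j) = mat_unit k l $ i $ j" for k l i j :: 'a
  proof -
    have "(\<Sum>x\<in>UNIV. \<Sum>y\<in>UNIV. mat_unit x y $ k $ l * mat_unit x y $ i $ j) =
        (\<Sum>x\<in>UNIV. \<Sum>y\<in>UNIV. mat_unit x y $ i $ j * mat_unit x y $ k $ l)"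
      by (simp add: mult.commute)
    also have "\<dots> = mat_unit k l $ i $ j"
      by (rule sum_mat_unit)
    finally show ?thesis
      by (simp add: max_ent_def kron_def)
  qed
  then show ?thesis
    by (simp add: choi_def id_tensor_def choi_kernel_def vec_lambda_eta)
qed

lemma clinear_map_nth:
  assumes "clinear_map L"
  shows "L X $ b $ b' = (\<Sum>a\<in>UNIV. \<Sum>a'\<in>UNIV. X $ a $ a' * choi_kernel L (a, b) (a', b'))"
  by (subst clinear_map_expand[OF assms]) (simp add: choi_kernel_def mat_scale_def)

lemma choi_kernel_transpose: "choi_kernel (transpose \<circ> L) = partial_transpose (choi_kernel L)"
  by (simp add: choi_kernel_def partial_transpose_def fun_eq_iff transpose_def)

text \<open>One direction of Choi's theorem. The definition of complete positivity is applied to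
  \<omega>, written as a block matrix with \<open>CARD('a)\<close> blocks numbered through
  \<open>e\<close>; \<omega> has rank one, with vector supported on the pairs
  \<open>(p, e p)\<close>.\<close>

lemma psd_choi_kernel:
  fixes T :: "complex^'a^'a::finite \<Rightarrow> complex^'b^'b::finite"
  assumes "completely_positive T"
  shows "psd_on UNIV (choi_kernel T)"
proof -
  let ?k = "CARD('a)"
  obtain e :: "nat \<Rightarrow> 'a" where e: "bij_betw e {..<?k} UNIV"
    using ex_bij_betw_nat_finite[of "UNIV :: 'a set"] by (auto simp: atLeast0LessThan)
  define f where "f = inv_into {..<?k} e"
  have f: "f a \<in> {..<?k}" "e (f a) = a" for a
    using e bij_betw_inv_into_right[OF e, of a] bij_betwE[OF bij_betw_inv_into[OF e]]
    by (auto simp: f_def)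
  have "block_psd ?k (\<lambda>p q. mat_unit (e p) (e q))"
  proof -
    have "psd_on ({..<?k} \<times> UNIV) (\<lambda>u v. cnj (case u of (p, i) \<Rightarrow> if i = e p then 1 else 0) *
        (case v of (p, i) \<Rightarrow> if i = e p then 1 else 0))"
      by (rule psd_on_rank_one)
    moreover have "(\<lambda>u v. cnj (case u of (p, i) \<Rightarrow> if i = e p then 1 else 0) *
        (case v of (p, i) \<Rightarrow> if i = e p then 1 else 0)) =
        (\<lambda>(p, i) (q, j). mat_unit (e p) (e q) $ i $ j)"
      by (auto simp: fun_eq_iff mat_unit_def)
    ultimately show ?thesis
      by (simp add: block_psd_def)
  qed
  then have "block_psd ?k (\<lambda>p q. T (mat_unit (e p) (e q)))"
    using assms by (simp add: completely_positive_def)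
  then have *: "psd_on ({..<?k} \<times> UNIV) (\<lambda>(p, i) (q, j). T (mat_unit (e p) (e q)) $ i $ j)"
    by (simp add: block_psd_def)
  have "psd_on UNIV (\<lambda>x y. (\<lambda>(p, i) (q, j). T (mat_unit (e p) (e q)) $ i $ j)
      (apfst f x) (apfst f y))"
    by (rule psd_on_pullback[OF *]) (use f in auto)
  moreover have "(\<lambda>x y. (\<lambda>(p, i) (q, j). T (mat_unit (e p) (e q)) $ i $ j)
      (apfst f x) (apfst f y)) = choi_kernel T"
    using f by (auto simp: fun_eq_iff choi_kernel_def)
  ultimately show ?thesis by simp
qed

section \<open>Tensor products over sites and duality with decomposable maps\<close>

definition tensor_kernel :: "('n \<Rightarrow> 'i \<Rightarrow> 'i \<Rightarrow> complex) \<Rightarrow> ('n::finite \<Rightarrow> 'i) \<Rightarrow> ('n \<Rightarrow> 'i) \<Rightarrow> complex" where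
  "tensor_kernel K p q = (\<Prod>k\<in>UNIV. K k (p k) (q k))"

text \<open>Transposes the second factor at every site at once, as composition of a map on the
  tensor power with \<open>transpose\<close> does to its Choi kernel.\<close>

definition tensor_partial_transpose ::
    "(('n \<Rightarrow> 'a \<times> 'b) \<Rightarrow> ('n \<Rightarrow> 'a \<times> 'b) \<Rightarrow> complex) \<Rightarrow> ('n \<Rightarrow> 'a \<times> 'b) \<Rightarrow> ('n \<Rightarrow> 'a \<times> 'b) \<Rightarrow> complex" where
  "tensor_partial_transpose W p q =
     W (\<lambda>k. (fst (p k), snd (q k))) (\<lambda>k. (fst (q k), snd (p k)))"

lemma tensor_partial_transpose_tensor_kernel:
  "tensor_partial_transpose (tensor_kernel K) = tensor_kernel (\<lambda>k. partial_transpose (K k))"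
  by (simp add: tensor_partial_transpose_def tensor_kernel_def partial_transpose_def fun_eq_iff)

lemma pairing_partial_transpose:
  fixes K W :: "'a::finite \<times> 'b::finite \<Rightarrow> _"
  shows "pairing K (partial_transpose W) = pairing (partial_transpose K) W"
  unfolding pairing_def partial_transpose_def sum.cartesian_product
  by (rule sum.reindex_bij_witness[where i = "\<lambda>(p, q). ((fst p, snd q), (fst q, snd p))"
        and j = "\<lambda>(p, q). ((fst p, snd q), (fst q, snd p))"]) auto

lemma pairing_tensor_partial_transpose:
  fixes K W :: "('n::finite \<Rightarrow> 'a::finite \<times> 'b::finite) \<Rightarrow> _"
  shows "pairing (tensor_partial_transpose K) W = pairing K (tensor_partial_transpose W)"
  unfolding pairing_def tensor_partial_transpose_def sum.cartesian_product
  by (rule sum.reindex_bij_witness[where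
        i = "\<lambda>(p, q). (\<lambda>k. (fst (p k), snd (q k)), \<lambda>k. (fst (q k), snd (p k)))" and
        j = "\<lambda>(p, q). (\<lambda>k. (fst (p k), snd (q k)), \<lambda>k. (fst (q k), snd (p k)))"]) auto

text \<open>The Choi matrix of a tensor power is the tensor power of the Choi matrix, once all input
  and output indices are regrouped site by site.\<close>

lemma choi_kernel_tensor_power:
  fixes P :: "complex^'a^'a::finite \<Rightarrow> complex^'b^'b::finite" and p q :: "'n::finite \<Rightarrow> 'a \<times> 'b"
  shows "choi_kernel (tensor_power P) (fst \<circ> p, snd \<circ> p) (fst \<circ> q, snd \<circ> q) =
    tensor_kernel (\<lambda>_. choi_kernel P) p q"
proof -
  have "(\<Sum>i\<in>UNIV. \<Sum>j\<in>UNIV. mat_unit a a' $ i $ j * f i j) = f a a'"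
    for a a' :: "'n \<Rightarrow> 'a" and f
  proof -
    have "(\<Sum>i\<in>UNIV. \<Sum>j\<in>UNIV. mat_unit a a' $ i $ j * f i j) =
        (\<Sum>i\<in>UNIV. \<Sum>j\<in>UNIV. f i j * mat_unit i j $ a $ a')"
      by (intro sum.cong refl) (auto simp: mat_unit_def)
    then show ?thesis by (simp only: sum_mat_unit)
  qed
  then show ?thesis
    by (simp add: choi_kernel_def tensor_power_def tensor_prod_def tensor_kernel_def mat_scale_def)
qed

text \<open>The Choi kernel splits into that of \<open>T1\<close> and the partial transpose of that
  of \<open>T2\<close>. Moving the partial transpose onto \<open>W\<close> leaves two pairings of
  positive semidefinite kernels.\<close>

lemma decomposable_tensor_power_pairing:
  fixes P :: "complex^'a^'a::finite \<Rightarrow> complex^'b^'b::finite"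
    and W :: "('n::finite \<Rightarrow> 'a \<times> 'b) \<Rightarrow> _"
  assumes dec: "decomposable (tensor_power P ::
           complex^('n \<Rightarrow> 'a)^('n \<Rightarrow> 'a) \<Rightarrow> complex^('n \<Rightarrow> 'b)^('n \<Rightarrow> 'b))"
    and W: "psd_on UNIV W" "psd_on UNIV (tensor_partial_transpose W)"
  shows "pairing (tensor_kernel (\<lambda>_. choi_kernel P)) W \<in> \<real>\<^sub>\<ge>\<^sub>0"
proof -
  obtain T1 T2 :: "complex^('n \<Rightarrow> 'a)^('n \<Rightarrow> 'a) \<Rightarrow> complex^('n \<Rightarrow> 'b)^('n \<Rightarrow> 'b)"
    where T: "completely_positive T1" "completely_positive T2"
      "tensor_power P = (\<lambda>X. T1 X + (transpose \<circ> T2) X)"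
    using dec unfolding decomposable_def by blast
  define h :: "('n \<Rightarrow> 'a \<times> 'b) \<Rightarrow> ('n \<Rightarrow> 'a) \<times> ('n \<Rightarrow> 'b)" where "h p = (fst \<circ> p, snd \<circ> p)" for p
  define C1 where "C1 p q = choi_kernel T1 (h p) (h q)" for p q
  define C2 where "C2 p q = choi_kernel T2 (h p) (h q)" for p q
  have psd: "psd_on UNIV C1" "psd_on UNIV C2"
    unfolding C1_def C2_def by (rule psd_on_pullback[OF psd_choi_kernel]; use T in simp)+
  have "tensor_kernel (\<lambda>_. choi_kernel P) = (\<lambda>p q. C1 p q + tensor_partial_transpose C2 p q)"
  proof (intro ext)
    fix p q
    show "tensor_kernel (\<lambda>_. choi_kernel P) p q = C1 p q + tensor_partial_transpose C2 p q"
    unfolding choi_kernel_tensor_power[symmetric] T(3) C1_def C2_def h_def tensor_partial_transpose_def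
    by (simp add: choi_kernel_def transpose_def comp_def)
  qed
  then have "pairing (tensor_kernel (\<lambda>_. choi_kernel P)) W =
      pairing C1 W + pairing C2 (tensor_partial_transpose W)"
    by (simp add: pairing_add_left pairing_tensor_partial_transpose)
  then show ?thesis
    using pairing_psd[OF psd(1) W(1)] pairing_psd[OF psd(2) W(2)] by simp
qed

section \<open>Positive maps\<close>

lemma positive_map_kernel:
  fixes P :: "complex^'a^'a::finite \<Rightarrow> complex^'b^'b::finite"
  assumes "positive_map P" "psd_on UNIV G"
  shows "psd_on UNIV (\<lambda>b b'. \<Sum>a\<in>UNIV. \<Sum>a'\<in>UNIV. G a a' * choi_kernel P (a, b) (a', b'))"
proof -
  have "psd (\<chi> a a'. G a a')"
    using assms(2) by (simp add: psd_def)
  then have "psd (P (\<chi> a a'. G a a'))"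
    using assms(1) by (simp add: positive_map_def)
  moreover have "clinear_map P"
    using assms(1) by (simp add: positive_map_def)
  ultimately show ?thesis
    by (simp add: psd_def clinear_map_nth)
qed

lemma positive_map_pairing:
  fixes P :: "complex^'a^'a::finite \<Rightarrow> complex^'b^'b::finite"
  assumes "positive_map P" "psd_on UNIV G" "psd_on UNIV H"
  shows "pairing (choi_kernel P) (\<lambda>p q. G (fst p) (fst q) * H (snd p) (snd q)) \<in> \<real>\<^sub>\<ge>\<^sub>0"
proof -
  have "pairing (\<lambda>b b'. \<Sum>a\<in>UNIV. \<Sum>a'\<in>UNIV. G a a' * choi_kernel P (a, b) (a', b')) H =
      (\<Sum>b\<in>UNIV. \<Sum>b'\<in>UNIV. \<Sum>a\<in>UNIV. \<Sum>a'\<in>UNIV. choi_kernel P (a, b) (a', b') * (G a a' * H b b'))"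
    unfolding pairing_def sum_distrib_right by (intro sum.cong refl) simp
  also have "\<dots> = (\<Sum>b\<in>UNIV. \<Sum>a\<in>UNIV. \<Sum>b'\<in>UNIV. \<Sum>a'\<in>UNIV. choi_kernel P (a, b) (a', b') * (G a a' * H b b'))"
    by (intro sum.cong refl sum.swap)
  also have "\<dots> = (\<Sum>a\<in>UNIV. \<Sum>b\<in>UNIV. \<Sum>a'\<in>UNIV. \<Sum>b'\<in>UNIV. choi_kernel P (a, b) (a', b') * (G a a' * H b b'))"
    by (subst sum.swap) (intro sum.cong refl sum.swap)
  also have "\<dots> = pairing (choi_kernel P) (\<lambda>p q. G (fst p) (fst q) * H (snd p) (snd q))"
    by (simp add: pairing_def sum_UNIV_prod)
  finally show ?thesis
    using pairing_psd[OF positive_map_kernel[OF assms(1,2)] assms(3)] by simp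
qed

text \<open>Positivity of the dual map on rank-one matrices: the form at \<open>v\<close> is the
  form of the image under \<open>P\<close> of the rank-one matrix of \<open>v\<close>, taken at
  \<open>y\<close>.\<close>

lemma positive_map_kernel_left:
  fixes P :: "complex^'a^'a::finite \<Rightarrow> complex^'b^'b::finite"
  assumes "positive_map P"
  shows "psd_on UNIV (\<lambda>a a'. \<Sum>b\<in>UNIV. \<Sum>b'\<in>UNIV. cnj (y b) * choi_kernel P (a, b) (a', b') * y b')"
  unfolding psd_on_def
proof
  fix v :: "'a \<Rightarrow> complex"
  have "(\<Sum>b\<in>UNIV. \<Sum>b'\<in>UNIV. cnj (y b) *
      (\<Sum>a\<in>UNIV. \<Sum>a'\<in>UNIV. (cnj (v a) * v a') * choi_kernel P (a, b) (a', b')) * y b') \<in> \<real>\<^sub>\<ge>\<^sub>0"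
    using positive_map_kernel[OF assms psd_on_rank_one] unfolding psd_on_def by blast
  also have "(\<Sum>b\<in>UNIV. \<Sum>b'\<in>UNIV. cnj (y b) *
      (\<Sum>a\<in>UNIV. \<Sum>a'\<in>UNIV. (cnj (v a) * v a') * choi_kernel P (a, b) (a', b')) * y b') =
      (\<Sum>a\<in>UNIV. \<Sum>a'\<in>UNIV. cnj (v a) *
      (\<Sum>b\<in>UNIV. \<Sum>b'\<in>UNIV. cnj (y b) * choi_kernel P (a, b) (a', b') * y b') * v a')"
    unfolding sum_distrib_left sum_distrib_right
    by (subst sum_swap4) (intro sum.cong refl, simp)
  finally show "(\<Sum>a\<in>UNIV. \<Sum>a'\<in>UNIV. cnj (v a) *
      (\<Sum>b\<in>UNIV. \<Sum>b'\<in>UNIV. cnj (y b) * choi_kernel P (a, b) (a', b') * y b') * v a') \<in> \<real>\<^sub>\<ge>\<^sub>0" .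
qed

text \<open>The Choi matrix need not be positive semidefinite, but contracting its output indices
  with any vector leaves a positive semidefinite, hence Hermitian, matrix. The defect
  \<open>K\<close> from Hermiticity therefore has zero quadratic form.\<close>

lemma positive_map_choi_hermitian:
  fixes P :: "complex^'a^'a::finite \<Rightarrow> complex^'b^'b::finite"
  assumes "positive_map P"
  shows "choi_kernel P q p = cnj (choi_kernel P p q)"
proof -
  obtain a b a' b' where pq: "p = (a, b)" "q = (a', b')" by fastforce
  define K where "K x y = choi_kernel P (a', x) (a, y) - cnj (choi_kernel P (a, y) (a', x))" for x y
  have "(\<Sum>x\<in>UNIV. \<Sum>y\<in>UNIV. cnj (v x) * K x y * v y) = 0" for v
  proof -
    let ?F = "\<lambda>a a'. \<Sum>b\<in>UNIV. \<Sum>b'\<in>UNIV. cnj (v b) * choi_kernel P (a, b) (a', b') * v b'"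
    have "?F a' a = cnj (?F a a')"
      by (rule psd_on_hermitian[OF positive_map_kernel_left[OF assms]]) auto
    also have "\<dots> = (\<Sum>x\<in>UNIV. \<Sum>y\<in>UNIV. cnj (v x) * cnj (choi_kernel P (a, y) (a', x)) * v y)"
      by (simp add: mult_ac) (rule sum.swap)
    finally show ?thesis
      by (simp add: K_def algebra_simps sum_subtractf)
  qed
  then have "K b' b = 0" by (rule quadratic_form_zero)
  then show ?thesis by (simp add: K_def pq)
qed

lemma positive_map_kernel_same:
  fixes P :: "complex^'a^'a::finite \<Rightarrow> complex^'b^'b::finite"
  assumes "positive_map P"
  shows "psd_on UNIV (\<lambda>a a'. choi_kernel P (a, b) (a', b))"
proof -
  have "(\<Sum>x\<in>UNIV. \<Sum>y\<in>UNIV. cnj (if x = b then 1 else 0) * choi_kernel P (a, x) (a', y) *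
      (if y = b then 1 else 0)) = choi_kernel P (a, b) (a', b)" for a a'
    by (simp add: if_distrib[of cnj] if_distrib[of "\<lambda>x. x * _"] if_distrib[of "\<lambda>x. _ * x"] cong: if_cong)
  then show ?thesis
    using positive_map_kernel_left[OF assms, of "\<lambda>x. if x = b then 1 else 0"] by simp
qed

text \<open>Otherwise the blocks with equal output indices vanish, so every rank-one matrix has an
  image with zero diagonal. Such an image is 0 by positivity, and rank-one matrices determine
  \<open>P\<close>.\<close>

lemma positive_map_choi_diag:
  fixes P :: "complex^'a^'a::finite \<Rightarrow> complex^'b^'b::finite"
  assumes "positive_map P" "P \<noteq> (\<lambda>X. 0)"
  shows "\<exists>p. 0 < Re (choi_kernel P p p)"
proof (rule ccontr)
  assume neg: "\<nexists>p. 0 < Re (choi_kernel P p p)"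
  let ?G = "\<lambda>x b b'. \<Sum>a\<in>UNIV. \<Sum>a'\<in>UNIV. (cnj (x a) * x a') * choi_kernel P (a, b) (a', b')"
  have psdG: "psd_on UNIV (?G x)" for x
    by (rule positive_map_kernel[OF assms(1) psd_on_rank_one])
  note psdF = positive_map_kernel_same[OF assms(1)]
  have "choi_kernel P (a, b) (a, b) = 0" for a b
    using psd_on_diag[OF psdF[of b], of a] neg by (auto simp: complex_nonneg_Reals_iff complex_eq_iff not_less order_antisym)
  then have "choi_kernel P (a, b) (a', b) = 0" for a a' b
    using psd_on_zero_diag(1)[OF psdF[of b], of a a'] by simp
  then have "?G x b b = 0" for x b
    by simp
  then have "?G x b b' = 0" for x b b'
    using psd_on_zero_diag(1)[OF psdG, of b b' x] by simp
  then have "(\<Sum>a\<in>UNIV. \<Sum>a'\<in>UNIV. cnj (x a) * choi_kernel P (a, b) (a', b') * x a') = 0" for x b b'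
    by (simp add: mult_ac)
  then have "choi_kernel P (a, b) (a', b') = 0" for a b a' b'
    by (rule quadratic_form_zero[where K = "\<lambda>a a'. choi_kernel P (a, b) (a', b')"])
  moreover have "clinear_map P"
    using assms(1) by (simp add: positive_map_def)
  ultimately have "P X = 0" for X
    by (simp add: vec_eq_iff clinear_map_nth)
  then show False
    using assms(2) by blast
qed

lemma pairing_hermitian_real:
  fixes K W :: "'i::finite \<Rightarrow> 'i \<Rightarrow> complex"
  assumes "\<And>p q. K q p = cnj (K p q)" "psd_on UNIV W"
  shows "pairing K W \<in> \<real>"
proof -
  have W: "W q p = cnj (W p q)" for p q
    by (rule psd_on_hermitian[OF assms(2)]) auto
  have "cnj (pairing K W) = (\<Sum>p\<in>UNIV. \<Sum>q\<in>UNIV. K q p * W q p)"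
    unfolding pairing_def cnj_sum complex_cnj_mult by (simp only: assms(1)[symmetric] W[symmetric])
  also have "\<dots> = pairing K W"
    unfolding pairing_def by (rule sum.swap)
  finally show ?thesis
    by (simp add: complex_is_Real_iff complex_eq_iff)
qed

section \<open>Test kernels\<close>

text \<open>
  \<open>X0\<close> and \<open>X1\<close> are images of \<open>1 \<otimes> 1\<close> and of \<open>\<omega>\<^sub>\<delta>\<close> under a map of the form
  \<open>A \<otimes> B\<close> with completely positive \<open>A\<close>, \<open>B\<close>: the conditions are what remains of
  \<open>0 \<le> \<omega> \<le> \<delta>\<close> and \<open>-1 \<le> F \<le> 1\<close>, where the flip \<open>F\<close> is the partial transpose of \<open>\<omega>\<close>.
\<close>
definition isotropic_pair :: "real \<Rightarrow> ('a \<times> 'b \<Rightarrow> 'a \<times> 'b \<Rightarrow> complex) \<Rightarrow> ('a \<times> 'b \<Rightarrow> 'a \<times> 'b \<Rightarrow> complex) \<Rightarrow> bool" where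
  "isotropic_pair \<delta> X0 X1 \<longleftrightarrow> psd_on UNIV X0 \<and> psd_on UNIV X1 \<and>
     psd_on UNIV (\<lambda>p q. complex_of_real \<delta> * X0 p q - X1 p q) \<and>
     psd_on UNIV (partial_transpose (\<lambda>p q. X0 p q + X1 p q)) \<and>
     psd_on UNIV (partial_transpose (\<lambda>p q. X0 p q - X1 p q))"

text \<open>Lagrange's identity in bilinear form; it serves as Cauchy-Schwarz with an explicit
  sum-of-squares remainder.\<close>

lemma sum_diff_product:
  fixes x y :: "'c::finite \<Rightarrow> complex"
  shows "(\<Sum>c\<in>UNIV. \<Sum>e\<in>UNIV. (x c - x e) * (y c - y e)) =
    2 * (of_nat CARD('c) * (\<Sum>c\<in>UNIV. x c * y c) - sum x UNIV * sum y UNIV)"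
proof -
  have "(\<Sum>c\<in>UNIV. \<Sum>e\<in>UNIV. (x c - x e) * (y c - y e)) =
      (\<Sum>c\<in>UNIV. \<Sum>e\<in>(UNIV :: 'c set). x c * y c) - (\<Sum>c\<in>UNIV. \<Sum>e\<in>UNIV. x c * y e)
      - (\<Sum>c\<in>UNIV. \<Sum>e\<in>UNIV. x e * y c) + (\<Sum>c\<in>(UNIV :: 'c set). \<Sum>e\<in>UNIV. x e * y e)"
    by (simp add: left_diff_distrib right_diff_distrib sum.distrib sum_subtractf)
  also have "(\<Sum>c\<in>UNIV. \<Sum>e\<in>(UNIV :: 'c set). x c * y c) = of_nat CARD('c) * (\<Sum>c\<in>UNIV. x c * y c)"
    by (simp add: sum_distrib_left)
  also have "(\<Sum>c\<in>UNIV. \<Sum>e\<in>UNIV. x c * y e) = sum x UNIV * sum y UNIV"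
    by (rule sum_product[symmetric])
  also have "(\<Sum>c\<in>UNIV. \<Sum>e\<in>UNIV. x e * y c) = sum x UNIV * sum y UNIV"
    by (subst sum.swap) (rule sum_product[symmetric])
  also have "(\<Sum>c\<in>(UNIV :: 'c set). \<Sum>e\<in>UNIV. x e * y e) = of_nat CARD('c) * (\<Sum>c\<in>UNIV. x c * y c)"
    by simp
  finally show ?thesis
    by algebra
qed

text \<open>\<open>X0\<close> is the sum of the rank-one kernels of all vectors
  \<open>L c e\<close>, while \<open>X1\<close> is the rank-one kernel of the sum of the diagonal
  ones. Each condition becomes an explicit sum of rank-one kernels.\<close>

lemma isotropic_pair_of_factorization:
  fixes s :: "'c::finite \<Rightarrow> 'a::finite \<Rightarrow> complex" and r :: "'c \<Rightarrow> 'b::finite \<Rightarrow> complex"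
  defines "G \<equiv> \<lambda>a a'. \<Sum>c\<in>UNIV. cnj (s c a) * s c a'"
    and "H \<equiv> \<lambda>b b'. \<Sum>c\<in>UNIV. cnj (r c b) * r c b'"
    and "w \<equiv> \<lambda>p. \<Sum>c\<in>UNIV. s c (fst p) * r c (snd p)"
  shows "isotropic_pair (real CARD('c)) (\<lambda>p q. G (fst p) (fst q) * H (snd p) (snd q)) (\<lambda>p q. cnj (w p) * w q)"
    (is "isotropic_pair _ ?X0 ?X1")
proof -
  define L where "L c e p = s c (fst p) * r e (snd p)" for c e p
  define M where "M c e p = s c (fst p) * cnj (r e (snd p))" for c e p
  have w: "w p = (\<Sum>c\<in>UNIV. L c c p)" for p
    by (simp add: w_def L_def)
  have X0: "?X0 p q = (\<Sum>c\<in>UNIV. \<Sum>e\<in>UNIV. cnj (L c e p) * L c e q)" for p q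
    unfolding G_def H_def L_def sum_product by (intro sum.cong refl) simp
  have 1: "psd_on UNIV ?X0"
    unfolding X0 by (intro psd_on_sum psd_on_rank_one)
  have 2: "psd_on UNIV ?X1"
    by (rule psd_on_rank_one)
  have 3: "psd_on UNIV (\<lambda>p q. complex_of_real (real CARD('c)) * ?X0 p q - ?X1 p q)"
  proof -
    \<comment> \<open>Cauchy-Schwarz for the diagonal vectors \<open>L c c\<close> leaves half of
      \<open>?D\<close>; the vectors with \<open>c \<noteq> e\<close> enter only through
      \<open>X0\<close> and form \<open>?O\<close>.\<close>
    let ?D = "\<lambda>p q. \<Sum>c\<in>UNIV. \<Sum>e\<in>UNIV. cnj (L c c p - L e e p) * (L c c q - L e e q)"
    let ?O = "\<lambda>p q. \<Sum>c\<in>UNIV. \<Sum>e\<in>UNIV. cnj (if c = e then 0 else L c e p) * (if c = e then 0 else L c e q)"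
    have D: "?D p q = 2 * (of_nat CARD('c) * (\<Sum>c\<in>UNIV. cnj (L c c p) * L c c q) - ?X1 p q)" for p q
      using sum_diff_product[of "\<lambda>c. cnj (L c c p)" "\<lambda>c. L c c q"] by (simp add: w)
    have O: "?X0 p q = (\<Sum>c\<in>UNIV. cnj (L c c p) * L c c q) + ?O p q" for p q
    proof -
      have "(\<Sum>e\<in>UNIV. cnj (L c e p) * L c e q) = cnj (L c c p) * L c c q +
          (\<Sum>e\<in>UNIV. cnj (if c = e then 0 else L c e p) * (if c = e then 0 else L c e q))" for c
      proof -
        have "(\<Sum>e\<in>UNIV. cnj (if c = e then 0 else L c e p) * (if c = e then 0 else L c e q)) =
            (\<Sum>e\<in>UNIV - {c}. cnj (L c e p) * L c e q)"
          by (rule sum.mono_neutral_cong_right) auto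
        then show ?thesis
          using sum.remove[of UNIV c "\<lambda>e. cnj (L c e p) * L c e q"] by simp
      qed
      then show ?thesis
        unfolding X0 by (simp add: sum.distrib)
    qed
    have eq: "complex_of_real (real CARD('c)) * ?X0 p q - ?X1 p q =
        complex_of_real (1/2) * ?D p q + complex_of_real (real CARD('c)) * ?O p q" for p q
      unfolding D O by (simp add: distrib_left right_diff_distrib)
    show ?thesis
      unfolding eq by (intro psd_on_add psd_on_scale psd_on_sum psd_on_rank_one) simp_all
  qed
  \<comment> \<open>Partial transposition conjugates the second factor, turning \<open>L\<close>
    into \<open>M\<close>. It maps \<open>X0\<close> to \<open>A\<close>, where \<open>M c e\<close>
    meets itself, and \<open>X1\<close> to \<open>B\<close>, where \<open>M c e\<close> meets
    \<open>M e c\<close>. For \<epsilon> = 1 or -1 the combination is half the sum of the squares of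
    \<open>M c e + \<epsilon> * M e c\<close>.\<close>
  have pt: "psd_on UNIV (partial_transpose (\<lambda>p q. ?X0 p q + complex_of_real \<epsilon> * ?X1 p q))"
    if "\<epsilon>\<^sup>2 = 1" for \<epsilon> :: real
  proof -
    let ?e = "complex_of_real \<epsilon>"
    have e: "?e * ?e = 1"
      using that by (simp add: power2_eq_square flip: of_real_mult)
    let ?f = "\<lambda>p q c e. cnj (M c e p) * M c e q" and ?g = "\<lambda>p q c e. cnj (M c e p) * M e c q"
    define A B where "A p q = (\<Sum>c\<in>UNIV. \<Sum>e\<in>UNIV. ?f p q c e)"
      and "B p q = (\<Sum>c\<in>UNIV. \<Sum>e\<in>UNIV. ?g p q c e)" for p q
    have X0_pt: "partial_transpose ?X0 p q = A p q" for p q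
      unfolding A_def partial_transpose_def G_def H_def M_def sum_product
      by (intro sum.cong refl) simp
    have X1_pt: "partial_transpose ?X1 p q = B p q" for p q
      unfolding B_def partial_transpose_def w_def M_def cnj_sum sum_product
      by (intro sum.cong refl) simp
    have swap: "(\<Sum>c\<in>UNIV. \<Sum>e\<in>UNIV. ?f p q e c) = A p q"
      "(\<Sum>c\<in>UNIV. \<Sum>e\<in>UNIV. ?g p q e c) = B p q" for p q
      unfolding A_def B_def by (rule sum.swap)+
    have expand: "cnj (M c e p + ?e * M e c p) * (M c e q + ?e * M e c q) =
        ?f p q c e + ?f p q e c + ?e * (?g p q c e + ?g p q e c)" for p q c e
    proof -
      have "(u + ?e * v) * (x + ?e * y) = u * x + ?e * ?e * (v * y) + ?e * (u * y + v * x)" for u v x y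
        by (simp add: algebra_simps)
      then show ?thesis by (simp add: e)
    qed
    have "(\<Sum>c\<in>UNIV. \<Sum>e\<in>UNIV. cnj (M c e p + ?e * M e c p) * (M c e q + ?e * M e c q)) =
        A p q + A p q + ?e * (B p q + B p q)" for p q
      unfolding expand by (simp only: sum.distrib sum_distrib_left[symmetric] swap flip: A_def B_def)
    moreover have "partial_transpose (\<lambda>p q. ?X0 p q + ?e * ?X1 p q) p q = A p q + ?e * B p q" for p q
      unfolding X0_pt[symmetric] X1_pt[symmetric] by (simp add: partial_transpose_def)
    ultimately have eq: "partial_transpose (\<lambda>p q. ?X0 p q + ?e * ?X1 p q) p q = complex_of_real (1/2) *
        (\<Sum>c\<in>UNIV. \<Sum>e\<in>UNIV. cnj (M c e p + ?e * M e c p) * (M c e q + ?e * M e c q))" for p q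
      by simp
    show ?thesis
      unfolding eq[abs_def] by (intro psd_on_scale psd_on_sum psd_on_rank_one) simp
  qed
  have 4: "psd_on UNIV (partial_transpose (\<lambda>p q. ?X0 p q + ?X1 p q))"
    using pt[of 1] by simp
  have 5: "psd_on UNIV (partial_transpose (\<lambda>p q. ?X0 p q - ?X1 p q))"
    using pt[of "-1"] by simp
  show ?thesis
    unfolding isotropic_pair_def by (intro conjI 1 2 3 4 5)
qed

section \<open>Orthonormalisation and a factorization indexed by the second system\<close>

definition cinner :: "('a::finite \<Rightarrow> complex) \<Rightarrow> ('a \<Rightarrow> complex) \<Rightarrow> complex" where
  "cinner u v = (\<Sum>a\<in>UNIV. cnj (u a) * v a)"

lemma cinner_cnj: "cnj (cinner u v) = cinner v u"
  by (simp add: cinner_def mult.commute)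

lemma cinner_sum_right: "cinner u (\<lambda>a. \<Sum>c\<in>S. f c * s c a) = (\<Sum>c\<in>S. f c * cinner u (s c))"
proof -
  have "cinner u (\<lambda>a. \<Sum>c\<in>S. f c * s c a) = (\<Sum>a\<in>UNIV. \<Sum>c\<in>S. f c * (cnj (u a) * s c a))"
    by (simp add: cinner_def sum_distrib_left mult_ac)
  also have "\<dots> = (\<Sum>c\<in>S. f c * cinner u (s c))"
    by (subst sum.swap) (simp add: cinner_def sum_distrib_left)
  finally show ?thesis .
qed

lemma cinner_diff_right: "cinner u (\<lambda>a. v a - v' a) = cinner u v - cinner u v'"
  by (simp add: cinner_def algebra_simps sum_subtractf)

lemma cinner_add_right: "cinner u (\<lambda>a. v a + v' a) = cinner u v + cinner u v'"
  by (simp add: cinner_def algebra_simps sum.distrib)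

lemma cinner_scale_left: "cinner (\<lambda>a. v a / complex_of_real c) u = cinner v u / complex_of_real c"
  by (simp add: cinner_def sum_divide_distrib)

lemma cinner_scale_right: "cinner u (\<lambda>a. v a / complex_of_real c) = cinner u v / complex_of_real c"
  by (simp add: cinner_def sum_divide_distrib)

lemma cinner_zero [simp]: "cinner (\<lambda>_. 0) u = 0" "cinner u (\<lambda>_. 0) = 0"
  by (simp_all add: cinner_def)

lemma cinner_self: "cinner u u = complex_of_real (\<Sum>a\<in>UNIV. (cmod (u a))\<^sup>2)"
  by (simp add: cinner_def mult_cnj_cmod mult.commute[of "cnj _"])

lemma cinner_self_eq_0: "cinner u u = 0 \<longleftrightarrow> u = (\<lambda>_. 0)"
  unfolding cinner_self of_real_eq_0_iff by (subst sum_nonneg_eq_0_iff) (auto simp: fun_eq_iff)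

text \<open>
  Gram-Schmidt, with \<open>s c = 0\<close> whenever \<open>w c\<close> depends linearly on the earlier vectors; so there may be
  more vectors than dimensions.
\<close>
lemma gram_schmidt:
  fixes w :: "'b \<Rightarrow> 'a::finite \<Rightarrow> complex"
  assumes "finite I"
  shows "\<exists>s. (\<forall>c\<in>I. \<forall>e\<in>I. c \<noteq> e \<longrightarrow> cinner (s c) (s e) = 0) \<and>
    (\<forall>c\<in>I. s c = (\<lambda>_. 0) \<or> cinner (s c) (s c) = 1) \<and>
    (\<forall>b\<in>I. w b = (\<lambda>a. \<Sum>c\<in>I. cinner (s c) (w b) * s c a))"
  using assms
proof (induction I rule: finite_induct)
  case (insert x I)
  obtain s where s: "\<forall>c\<in>I. \<forall>e\<in>I. c \<noteq> e \<longrightarrow> cinner (s c) (s e) = 0"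
      "\<forall>c\<in>I. s c = (\<lambda>_. 0) \<or> cinner (s c) (s c) = 1"
      "\<forall>b\<in>I. w b = (\<lambda>a. \<Sum>c\<in>I. cinner (s c) (w b) * s c a)"
    using insert.IH by (elim exE conjE) (rule that)
  note orth = s(1)[rule_format] and unit = s(2)[rule_format] and span = s(3)[rule_format]
  define t where "t = (\<lambda>a. w x a - (\<Sum>c\<in>I. cinner (s c) (w x) * s c a))"
  define \<rho> where "\<rho> = sqrt (\<Sum>a\<in>UNIV. (cmod (t a))\<^sup>2)"
  have \<rho>: "cinner t t = complex_of_real \<rho> * complex_of_real \<rho>"
    unfolding cinner_self \<rho>_def of_real_mult[symmetric]
    by (simp add: sum_nonneg)
  have st: "cinner (s e) t = 0" if "e \<in> I" for e
  proof -
    have "cinner (s e) t = cinner (s e) (w x) - (\<Sum>c\<in>I. cinner (s c) (w x) * cinner (s e) (s c))"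
      by (simp add: t_def cinner_diff_right cinner_sum_right)
    also have "(\<Sum>c\<in>I. cinner (s c) (w x) * cinner (s e) (s c)) =
        (\<Sum>c\<in>I. if c = e then cinner (s e) (w x) * cinner (s e) (s e) else 0)"
      using orth that by (intro sum.cong) auto
    also have "\<dots> = cinner (s e) (w x)"
      using unit[OF that] that insert.hyps by auto
    finally show ?thesis by simp
  qed
  then have ts: "cinner t (s e) = 0" if "e \<in> I" for e
    using that cinner_cnj[of "s e" t] by simp
  have tw: "cinner t (w b) = 0" if "b \<in> I" for b
    by (subst span[OF that]) (simp add: cinner_sum_right ts)
  have wx: "w x = (\<lambda>a. (\<Sum>c\<in>I. cinner (s c) (w x) * s c a) + t a)"
    by (simp add: t_def)
  have twx: "cinner t (w x) = complex_of_real \<rho> * complex_of_real \<rho>"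
    by (subst wx) (simp add: cinner_add_right cinner_sum_right ts \<rho>)
  \<comment> \<open>If the residual \<open>t\<close> vanishes, then \<rho> = 0 and division by zero
    gives the zero vector, the intended value for a dependent \<open>w x\<close>.\<close>
  define s' where "s' = s(x := (\<lambda>a. t a / complex_of_real \<rho>))"
  have s': "s' x = (\<lambda>a. t a / complex_of_real \<rho>)" "\<And>c. c \<in> I \<Longrightarrow> s' c = s c"
    using insert.hyps by (auto simp: s'_def)
  have t0: "t a = 0" if "\<rho> = 0" for a
    using that \<rho> cinner_self_eq_0[of t] by simp
  have 1: "cinner (s' c) (s' e) = 0" if "c \<in> insert x I" "e \<in> insert x I" "c \<noteq> e" for c e
    using that by (auto simp: s' cinner_scale_left cinner_scale_right st ts orth)
  have 2: "s' c = (\<lambda>_. 0) \<or> cinner (s' c) (s' c) = 1" if "c \<in> insert x I" for c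
  proof (cases "c = x")
    case True
    then show ?thesis
      using t0 by (cases "\<rho> = 0") (simp_all add: s' cinner_scale_left cinner_scale_right \<rho>)
  next
    case False
    then show ?thesis
      using that unit[of c] by (simp add: s')
  qed
  have 3: "w b = (\<lambda>a. \<Sum>c\<in>insert x I. cinner (s' c) (w b) * s' c a)" if "b \<in> insert x I" for b
  proof
    fix a
    have "(\<Sum>c\<in>insert x I. cinner (s' c) (w b) * s' c a) =
        cinner (s' x) (w b) * s' x a + (\<Sum>c\<in>I. cinner (s c) (w b) * s c a)"
      using insert.hyps s' by simp
    also have "\<dots> = w b a"
    proof (cases "b = x")
      case True
      have "cinner (s' x) (w x) * s' x a = t a"
        using t0 by (cases "\<rho> = 0") (simp_all add: s' cinner_scale_left twx)
      then show ?thesis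
        using True by (simp add: t_def)
    next
      case False
      then have "b \<in> I" using that by simp
      then show ?thesis
        using fun_cong[OF span[OF \<open>b \<in> I\<close>], of a, symmetric] by (simp add: s' cinner_scale_left tw)
    qed
    finally show "w b a = (\<Sum>c\<in>insert x I. cinner (s' c) (w b) * s' c a)" ..
  qed
  show ?case
    by (rule exI[of _ s'], intro conjI ballI impI)
      (rule 1, assumption+, rule 2, assumption, rule 3, assumption)
qed simp

text \<open>A substitute for the Schmidt decomposition with only \<open>CARD('b)\<close> terms:
  \<open>s\<close> orthonormalises the vectors \<open>w (_, b)\<close> up to zero vectors, and
  \<open>r\<close> holds the coefficients. The inner products of the \<open>w (_, b)\<close> are
  then those of the coefficients, and the vectors \<open>s c\<close> sum to an orthogonal
  projection.\<close>

lemma reduced_factorization: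
  fixes w :: "'a::finite \<times> 'b::finite \<Rightarrow> complex"
  obtains s :: "'b \<Rightarrow> 'a \<Rightarrow> complex" and r :: "'b \<Rightarrow> 'b \<Rightarrow> complex" where
    "\<And>a b. w (a, b) = (\<Sum>c\<in>UNIV. s c a * r c b)"
    "\<And>b b'. (\<Sum>a\<in>UNIV. cnj (w (a, b)) * w (a, b')) = (\<Sum>c\<in>UNIV. cnj (r c b) * r c b')"
    "psd_on UNIV (\<lambda>a a'. (if a = a' then 1 else 0) - (\<Sum>c\<in>UNIV. cnj (s c a) * s c a'))"
proof -
  obtain s where s: "\<forall>c\<in>UNIV. \<forall>e\<in>UNIV. c \<noteq> e \<longrightarrow> cinner (s c) (s e) = 0"
      "\<forall>c\<in>UNIV. s c = (\<lambda>_. 0) \<or> cinner (s c) (s c) = 1"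
      "\<forall>b\<in>UNIV. (\<lambda>a. w (a, b)) = (\<lambda>a. \<Sum>c\<in>(UNIV :: 'b set). cinner (s c) (\<lambda>a. w (a, b)) * s c a)"
    using gram_schmidt[OF finite, of UNIV "\<lambda>b a. w (a, b)"] by (elim exE conjE) (rule that)
  note orth = s(1)[rule_format, OF UNIV_I UNIV_I] and unit = s(2)[rule_format, OF UNIV_I]
    and span = s(3)[rule_format, OF UNIV_I]
  define r where "r c b = cinner (s c) (\<lambda>a. w (a, b))" for c b
  show thesis
  proof (rule that[of s r])
    show "w (a, b) = (\<Sum>c\<in>UNIV. s c a * r c b)" for a b
    proof -
      have "w (a, b) = (\<Sum>c\<in>UNIV. cinner (s c) (\<lambda>a. w (a, b)) * s c a)"
        by (rule fun_cong[OF span])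
      then show ?thesis
        by (simp only: r_def mult.commute)
    qed
    show "(\<Sum>a\<in>UNIV. cnj (w (a, b)) * w (a, b')) = (\<Sum>c\<in>UNIV. cnj (r c b) * r c b')" for b b'
    proof -
      have "cinner (\<lambda>a. w (a, b)) (\<lambda>a. w (a, b')) = (\<Sum>c\<in>UNIV. r c b' * cnj (r c b))"
        by (subst (2) span) (simp add: cinner_sum_right r_def cinner_cnj)
      then show ?thesis
        by (simp add: cinner_def mult.commute)
    qed
    define G where "G a a' = (\<Sum>c\<in>UNIV. cnj (s c a) * s c a')" for a a'
    \<comment> \<open>\<open>G\<close> is a Hermitian idempotent, so 1 - \<open>G\<close> equals its
      own Gram matrix, from which positivity is read off below.\<close>
    have GG: "(\<Sum>e\<in>UNIV. cnj (G e a) * G e a') = G a a'" for a a'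
    proof -
      have G: "G e a = (\<Sum>c\<in>UNIV. s c a * cnj (s c e))" for e a
        by (simp add: G_def mult.commute)
      have "cinner (\<lambda>e. G e a) (\<lambda>e. \<Sum>c\<in>UNIV. s c a' * cnj (s c e)) =
          (\<Sum>c\<in>UNIV. s c a' * cinner (\<lambda>e. G e a) (\<lambda>e. cnj (s c e)))"
        by (rule cinner_sum_right)
      also have "\<dots> = (\<Sum>c\<in>UNIV. s c a' * cnj (s c a))"
      proof (intro sum.cong refl arg_cong2[where f = "(*)"])
        fix c
        have "cinner (\<lambda>e. cnj (s c e)) (\<lambda>e. G e a) = (\<Sum>d\<in>UNIV. s d a * cinner (\<lambda>e. cnj (s c e)) (\<lambda>e. cnj (s d e)))"
          unfolding G by (rule cinner_sum_right)
        also have "\<dots> = (\<Sum>d\<in>UNIV. if d = c then s c a else 0)"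
        proof (intro sum.cong refl)
          fix d
          have *: "cinner (\<lambda>e. cnj (s c e)) (\<lambda>e. cnj (s d e)) = cinner (s d) (s c)"
            by (simp add: cinner_def mult.commute)
          show "s d a * cinner (\<lambda>e. cnj (s c e)) (\<lambda>e. cnj (s d e)) = (if d = c then s c a else 0)"
            using orth[of d c] unit[of c] unfolding * by (cases "d = c") auto
        qed
        also have "\<dots> = s c a" by simp
        finally show "cinner (\<lambda>e. G e a) (\<lambda>e. cnj (s c e)) = cnj (s c a)"
          by (metis cinner_cnj)
      qed
      finally show ?thesis
        by (simp add: cinner_def mult.commute flip: G)
    qed
    have G_cnj: "cnj (G a a') = G a' a" for a a'
      by (simp add: G_def mult.commute)
    have "psd_on UNIV (\<lambda>a a'. \<Sum>e\<in>UNIV. cnj ((if e = a then 1 else 0) - G e a) * ((if e = a' then 1 else 0) - G e a'))"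
      by (intro psd_on_sum psd_on_rank_one)
    also have "(\<lambda>a a'. \<Sum>e\<in>UNIV. cnj ((if e = a then 1 else 0) - G e a) * ((if e = a' then 1 else 0) - G e a')) =
        (\<lambda>a a'. (if a = a' then 1 else 0) - G a a')"
    proof (intro ext)
      fix a a'
      have "(\<Sum>e\<in>UNIV. cnj ((if e = a then 1 else 0) - G e a) * ((if e = a' then 1 else 0) - G e a')) =
          (\<Sum>e\<in>UNIV. (if e = a then (if e = a' then 1 else 0) else 0) - (if e = a then G e a' else 0)
            - (if e = a' then cnj (G e a) else 0) + cnj (G e a) * G e a')"
        by (intro sum.cong refl) (auto simp: algebra_simps)
      also have "\<dots> = (if a = a' then 1 else 0) - G a a' - cnj (G a' a) + G a a'"
        by (simp add: sum.distrib sum_subtractf GG)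
      finally show "(\<Sum>e\<in>UNIV. cnj ((if e = a then 1 else 0) - G e a) * ((if e = a' then 1 else 0) - G e a')) =
          (if a = a' then 1 else 0) - G a a'"
        by (simp add: G_cnj)
    qed
    finally show "psd_on UNIV (\<lambda>a a'. (if a = a' then 1 else 0) - (\<Sum>c\<in>UNIV. cnj (s c a) * s c a'))"
      by (simp add: G_def)
  qed
qed

section \<open>Extracting a test kernel from mu\<close>

lemma trace_eq_hs_inner: "trace Y = hs_inner (mat 1) Y"
proof -
  have "(\<Sum>j\<in>UNIV. cnj (if i = j then 1 else 0) * Y $ i $ j) = Y $ i $ i" for i
    by (simp add: if_distrib[of cnj] if_distrib[of "\<lambda>x. x * _"] cong: if_cong)
  then show ?thesis
    by (simp add: hs_inner_eq trace_def mat_def)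
qed

lemma trace_adjoint_comp:
  assumes "clinear_map T"
  shows "trace ((hs_adjoint T \<circ> P) (mat 1)) = hs_inner (T (mat 1)) (P (mat 1))"
  by (simp add: trace_eq_hs_inner hs_adjoint_works[OF assms])

lemma clinear_map_one:
  assumes "clinear_map L"
  shows "L (mat 1) $ b $ b' = (\<Sum>a\<in>UNIV. choi_kernel L (a, b) (a, b'))"
  by (simp add: clinear_map_nth[OF assms] mat_def if_distrib[of "\<lambda>x. x * _"] cong: if_cong)

text \<open>A map with a single Kraus operator, one matrix unit; it supplies the admissible
  \<open>T\<close> in \<open>mu_set_nonempty\<close>.\<close>

lemma completely_positive_corner:
  fixes p :: "'a::finite \<times> 'b::finite"
  shows "completely_positive (\<lambda>X :: complex^'a^'a. mat_scale (X $ fst p $ fst p) (mat_unit (snd p) (snd p)) :: complex^'b^'b)"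
  unfolding completely_positive_def
proof (intro conjI allI impI)
  show "clinear_map (\<lambda>X :: complex^'a^'a. mat_scale (X $ fst p $ fst p) (mat_unit (snd p) (snd p)) :: complex^'b^'b)"
    by (simp add: clinear_map_iff mat_scale_def vec_eq_iff algebra_simps)
  fix k and X :: "nat \<Rightarrow> nat \<Rightarrow> complex^'a^'a"
  assume "block_psd k X"
  then have *: "psd_on ({..<k} \<times> UNIV) (\<lambda>(u, i) (v, j). X u v $ i $ j)"
    by (simp add: block_psd_def)
  have "psd_on ({..<k} \<times> (UNIV :: 'b set)) (\<lambda>x y. (\<lambda>(u, i) (v, j). X u v $ i $ j) (fst x, fst p) (fst y, fst p))"
    by (rule psd_on_pullback[OF *]) auto
  then have "psd_on ({..<k} \<times> (UNIV :: 'b set)) (\<lambda>x y. cnj (if snd x = snd p then 1 else 0) * (if snd y = snd p then 1 else 0) *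
      (\<lambda>(u, i) (v, j). X u v $ i $ j) (fst x, fst p) (fst y, fst p))"
    by (rule psd_on_diag_scale)
  also have "(\<lambda>x y. cnj (if snd x = snd p then 1 else 0) * (if snd y = snd p then 1 else 0) *
      (\<lambda>(u, i) (v, j). X u v $ i $ j) (fst x, fst p) (fst y, fst p)) =
      (\<lambda>(u, i) (v, j). mat_scale (X u v $ fst p $ fst p) (mat_unit (snd p) (snd p)) $ i $ j)"
    by (auto simp: fun_eq_iff mat_scale_def mat_unit_def)
  finally show "block_psd k (\<lambda>u v. mat_scale (X u v $ fst p $ fst p) (mat_unit (snd p) (snd p)) :: complex^'b^'b)"
    by (simp add: block_psd_def)
qed

lemma mu_set_nonempty:
  fixes P :: "complex^'a^'a::finite \<Rightarrow> complex^'b^'b::finite"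
  assumes "positive_map P" "P \<noteq> (\<lambda>X. 0)"
  shows "\<exists>T :: complex^'a^'a \<Rightarrow> complex^'b^'b. completely_positive T \<and> (hs_adjoint T \<circ> P) (mat 1) \<noteq> 0"
proof -
  \<comment> \<open>For the corner map at this entry the denominator is the diagonal entry of
    \<open>P (mat 1)\<close> at \<open>b0\<close>, a sum of non-negative Choi entries including the
    positive one.\<close>
  obtain a0 b0 where p: "0 < Re (choi_kernel P (a0, b0) (a0, b0))"
    using positive_map_choi_diag[OF assms] by auto
  define T where "T = (\<lambda>X :: complex^'a^'a. mat_scale (X $ a0 $ a0) (mat_unit b0 b0) :: complex^'b^'b)"
  have T: "completely_positive T"
    using completely_positive_corner[of "(a0, b0)"] by (simp add: T_def)
  have lin: "clinear_map T" "clinear_map P"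
    using T assms by (simp_all add: completely_positive_def positive_map_def)
  have diag: "choi_kernel P (a, b) (a, b) \<in> \<real>\<^sub>\<ge>\<^sub>0" for a b
    using psd_on_diag[OF positive_map_kernel_same[OF assms(1)]] by simp
  have "T (mat 1) = mat_unit b0 b0"
    by (simp add: T_def mat_scale_def mat_def vec_eq_iff)
  then have "trace ((hs_adjoint T \<circ> P) (mat 1)) = (\<Sum>a\<in>UNIV. choi_kernel P (a, b0) (a, b0))"
    by (simp only: trace_adjoint_comp[OF lin(1)] hs_inner_mat_unit clinear_map_one[OF lin(2)])
  moreover have "0 < Re (\<Sum>a\<in>UNIV. choi_kernel P (a, b0) (a, b0))"
    unfolding Re_sum by (rule sum_pos2[of _ a0]) (use p diag in \<open>auto simp: complex_nonneg_Reals_iff\<close>)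
  ultimately have "(hs_adjoint T \<circ> P) (mat 1) \<noteq> 0"
    by (auto simp: trace_def simp del: Re_sum)
  then show ?thesis
    using T by blast
qed

text \<open>
  Both traces in the quotient are sums over the Kraus operators of \<open>T\<close>, so one of these operators,
  here \<open>w\<close>, alone achieves the bound.
\<close>
lemma mu_less_obtain_kraus:
  fixes P :: "complex^'a^'a::finite \<Rightarrow> complex^'b^'b::finite"
  assumes P: "positive_map P" "P \<noteq> (\<lambda>X. 0)" and c: "mu P < c" "c \<le> 0"
  obtains w :: "'a \<times> 'b \<Rightarrow> complex" where
    "Re (pairing (choi_kernel P) (\<lambda>p q. cnj (w p) * w q)) <
     c * Re (pairing (choi_kernel P)
       (\<lambda>p q. (if fst p = fst q then 1 else 0) * (\<Sum>a\<in>UNIV. cnj (w (a, snd p)) * w (a, snd q))))"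
proof -
  let ?C = "choi_kernel P"
  let ?S = "{Re (trace (choi P ** choi T)) / Re (trace ((hs_adjoint T \<circ> P) (mat 1))) | T.
                 completely_positive T \<and> (hs_adjoint T \<circ> P) (mat 1) \<noteq> 0}"
  \<comment> \<open>Only for a non-empty set does an infimum below \<open>c\<close> provide an
    element below \<open>c\<close>.\<close>
  have "?S \<noteq> {}"
    using mu_set_nonempty[OF P] by blast
  then have "\<not> (\<forall>x\<in>?S. c \<le> x)"
    using c(1) cInf_greatest[of ?S c] unfolding mu_def by force
  then obtain T where T: "completely_positive T"
    and less: "Re (trace (choi P ** choi T)) / Re (trace ((hs_adjoint T \<circ> P) (mat 1))) < c"
    by (auto simp: not_le)
  have lin: "clinear_map T" "clinear_map P"
    using T P by (simp_all add: completely_positive_def positive_map_def)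
  obtain x :: "'a \<times> 'b \<Rightarrow> 'a \<times> 'b \<Rightarrow> complex" where "\<forall>p\<in>UNIV. \<forall>q\<in>UNIV. choi_kernel T p q = (\<Sum>k\<in>UNIV. cnj (x k p) * x k q)"
    using psd_on_decompose[OF finite psd_choi_kernel[OF T]] by (elim exE) (rule that)
  then have x: "choi_kernel T p q = (\<Sum>k\<in>UNIV. cnj (x k p) * x k q)" for p q
    by blast
  \<comment> \<open>A trace of a product transposes one factor, whereas \<open>pairing\<close> does
    not; conjugating the Kraus vectors accounts for the difference.\<close>
  define w where "w k p = cnj (x k p)" for k p
  have Tw: "choi_kernel T p q = (\<Sum>k\<in>UNIV. cnj (w k q) * w k p)" for p q
    by (simp add: x w_def mult.commute)
  define N where "N k = pairing ?C (\<lambda>p q. cnj (w k p) * w k q)" for k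
  define D where "D k = pairing ?C (\<lambda>p q. (if fst p = fst q then 1 else 0) *
      (\<Sum>a\<in>UNIV. cnj (w k (a, snd p)) * w k (a, snd q)))" for k
  have "trace (choi P ** choi T) = (\<Sum>p\<in>UNIV. \<Sum>q\<in>UNIV. \<Sum>k\<in>UNIV. ?C p q * (cnj (w k p) * w k q))"
    by (simp add: trace_def matrix_matrix_mult_def choi_nth Tw sum_distrib_left)
  also have "\<dots> = (\<Sum>p\<in>UNIV. \<Sum>k\<in>UNIV. \<Sum>q\<in>UNIV. ?C p q * (cnj (w k p) * w k q))"
    by (intro sum.cong refl sum.swap)
  also have "\<dots> = (\<Sum>k\<in>UNIV. N k)"
    unfolding N_def pairing_def by (rule sum.swap)
  finally have num: "trace (choi P ** choi T) = (\<Sum>k\<in>UNIV. N k)" .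
  have D: "D k = (\<Sum>b\<in>UNIV. \<Sum>b'\<in>UNIV. (\<Sum>a\<in>UNIV. cnj (w k (a, b)) * w k (a, b')) * P (mat 1) $ b $ b')" for k
  proof -
    let ?H = "\<lambda>b b'. \<Sum>a\<in>UNIV. cnj (w k (a, b)) * w k (a, b')"
    have "D k = (\<Sum>a\<in>UNIV. \<Sum>b\<in>UNIV. \<Sum>a'\<in>UNIV. \<Sum>b'\<in>UNIV. if a = a' then ?C (a, b) (a', b') * ?H b b' else 0)"
      unfolding D_def pairing_def sum_UNIV_prod by (intro sum.cong refl) simp
    also have "\<dots> = (\<Sum>a\<in>UNIV. \<Sum>b\<in>UNIV. \<Sum>b'\<in>UNIV. \<Sum>a'\<in>UNIV. if a = a' then ?C (a, b) (a', b') * ?H b b' else 0)"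
      by (intro sum.cong refl sum.swap)
    also have "\<dots> = (\<Sum>a\<in>UNIV. \<Sum>b\<in>UNIV. \<Sum>b'\<in>UNIV. ?C (a, b) (a, b') * ?H b b')"
      by simp
    also have "\<dots> = (\<Sum>b\<in>UNIV. \<Sum>a\<in>UNIV. \<Sum>b'\<in>UNIV. ?C (a, b) (a, b') * ?H b b')"
      by (rule sum.swap)
    also have "\<dots> = (\<Sum>b\<in>UNIV. \<Sum>b'\<in>UNIV. \<Sum>a\<in>UNIV. ?C (a, b) (a, b') * ?H b b')"
      by (intro sum.cong refl sum.swap)
    also have "\<dots> = (\<Sum>b\<in>UNIV. \<Sum>b'\<in>UNIV. ?H b b' * P (mat 1) $ b $ b')"
      by (simp add: clinear_map_one[OF lin(2)] mult.commute flip: sum_distrib_right)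
    finally show ?thesis .
  qed
  have "cnj (T (mat 1) $ b $ b') = (\<Sum>k\<in>UNIV. \<Sum>a\<in>UNIV. cnj (w k (a, b)) * w k (a, b'))" for b b'
    unfolding clinear_map_one[OF lin(1)] Tw by (subst sum.swap) (simp add: mult.commute)
  then have "trace ((hs_adjoint T \<circ> P) (mat 1)) = (\<Sum>b\<in>UNIV. \<Sum>b'\<in>UNIV. \<Sum>k\<in>UNIV.
      (\<Sum>a\<in>UNIV. cnj (w k (a, b)) * w k (a, b')) * P (mat 1) $ b $ b')"
    unfolding trace_adjoint_comp[OF lin(1)] hs_inner_eq by (simp only: sum_distrib_right)
  also have "\<dots> = (\<Sum>b\<in>UNIV. \<Sum>k\<in>UNIV. \<Sum>b'\<in>UNIV.
      (\<Sum>a\<in>UNIV. cnj (w k (a, b)) * w k (a, b')) * P (mat 1) $ b $ b')"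
    by (intro sum.cong refl sum.swap)
  also have "\<dots> = (\<Sum>k\<in>UNIV. D k)"
    unfolding D by (rule sum.swap)
  finally have den: "trace ((hs_adjoint T \<circ> P) (mat 1)) = (\<Sum>k\<in>UNIV. D k)" .
  have "0 \<le> Re (D k)" for k
  proof -
    have one: "psd_on UNIV (\<lambda>a a' :: 'a. if a = a' then 1 else 0)"
    proof -
      have "psd_on UNIV (\<lambda>a a' :: 'a. \<Sum>e\<in>UNIV. cnj (if e = a then 1 else 0) * (if e = a' then 1 else 0))"
        by (intro psd_on_sum psd_on_rank_one)
      then show ?thesis
        by (simp add: if_distrib[of cnj] if_distrib[of "\<lambda>x. x * _"] cong: if_cong)
    qed
    have "psd_on UNIV (\<lambda>b b'. \<Sum>a\<in>UNIV. cnj (w k (a, b)) * w k (a, b'))"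
      by (intro psd_on_sum psd_on_rank_one)
    from positive_map_pairing[OF P(1) one this] show ?thesis
      unfolding D_def by (simp add: complex_nonneg_Reals_iff)
  qed
  then have den_nonneg: "0 \<le> (\<Sum>k\<in>UNIV. Re (D k))"
    by (intro sum_nonneg) simp
  have "(\<Sum>k\<in>UNIV. Re (N k)) < c * (\<Sum>k\<in>UNIV. Re (D k))"
  proof (cases "(\<Sum>k\<in>UNIV. Re (D k)) = 0")
    \<comment> \<open>A zero denominator makes the quotient 0 by convention, so \<open>less\<close>
      would read \<open>0 < c\<close>, against \<open>c \<le> 0\<close>.\<close>
    case True
    then show ?thesis using less c(2) unfolding num den by simp
  next
    case False
    then show ?thesis
      using less den_nonneg unfolding num den by (simp add: pos_divide_less_eq)
  qed
  then have "(\<Sum>k\<in>UNIV. Re (N k)) < (\<Sum>k\<in>UNIV. c * Re (D k))"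
    by (simp add: sum_distrib_left)
  \<comment> \<open>A strict inequality between two sums is strict in some summand, so this
    \<open>w k\<close> suffices.\<close>
  then obtain k where "Re (N k) < c * Re (D k)"
    using sum_mono[of UNIV "\<lambda>k. c * Re (D k)" "\<lambda>k. Re (N k)"] by (metis not_le UNIV_I)
  then show thesis
    using that[of "w k"] by (simp add: N_def D_def)
qed

text \<open>Expanding \<open>w\<close> in the standard basis of the first system gives
  \<open>CARD('a)\<close> terms, and \<open>X0\<close> is exactly the kernel in the
  denominator.\<close>

lemma mu_less_obtain_pair_left:
  fixes P :: "complex^'a^'a::finite \<Rightarrow> complex^'b^'b::finite"
  assumes "positive_map P" "P \<noteq> (\<lambda>X. 0)" "mu P < c" "c \<le> 0"
  shows "\<exists>X0 X1. isotropic_pair (real CARD('a)) X0 X1 \<and>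
    Re (pairing (choi_kernel P) X1) < c * Re (pairing (choi_kernel P) X0)"
proof -
  obtain w where w: "Re (pairing (choi_kernel P) (\<lambda>p q. cnj (w p) * w q)) <
     c * Re (pairing (choi_kernel P)
       (\<lambda>p q. (if fst p = fst q then 1 else 0) * (\<Sum>a\<in>UNIV. cnj (w (a, snd p)) * w (a, snd q))))"
    using mu_less_obtain_kraus[OF assms] by blast
  let ?s = "\<lambda>c a :: 'a. if c = a then 1 else 0 :: complex"
  have G: "(\<Sum>c\<in>UNIV. cnj (?s c a) * ?s c a') = (if a = a' then 1 else 0)" for a a'
    by (simp add: if_distrib[of cnj] if_distrib[of "\<lambda>x. x * _"] cong: if_cong)
  have W: "(\<Sum>c\<in>UNIV. ?s c (fst p) * w (c, snd p)) = w p" for p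
    by (simp add: if_distrib[of "\<lambda>x. x * _"] cong: if_cong)
  show ?thesis
    using isotropic_pair_of_factorization[of ?s "\<lambda>c b. w (c, b)"] w unfolding G W by blast
qed

text \<open>With \<open>CARD('b)\<close> terms the first factor of \<open>X0\<close> is only a
  projection below the identity. Passing to it cannot increase the denominator, and since
  \<open>c \<le> 0\<close> the strict bound survives.\<close>

lemma mu_less_obtain_pair_right:
  fixes P :: "complex^'a^'a::finite \<Rightarrow> complex^'b^'b::finite"
  assumes "positive_map P" "P \<noteq> (\<lambda>X. 0)" "mu P < c" "c \<le> 0"
  shows "\<exists>X0 X1. isotropic_pair (real CARD('b)) X0 X1 \<and>
    Re (pairing (choi_kernel P) X1) < c * Re (pairing (choi_kernel P) X0)"
proof -
  obtain w where w: "Re (pairing (choi_kernel P) (\<lambda>p q. cnj (w p) * w q)) <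
     c * Re (pairing (choi_kernel P)
       (\<lambda>p q. (if fst p = fst q then 1 else 0) * (\<Sum>a\<in>UNIV. cnj (w (a, snd p)) * w (a, snd q))))"
    using mu_less_obtain_kraus[OF assms] by blast
  obtain s :: "'b \<Rightarrow> 'a \<Rightarrow> complex" and r where
    sr: "\<And>a b. w (a, b) = (\<Sum>c\<in>UNIV. s c a * r c b)"
    and H: "\<And>b b'. (\<Sum>a\<in>UNIV. cnj (w (a, b)) * w (a, b')) = (\<Sum>c\<in>UNIV. cnj (r c b) * r c b')"
    and G: "psd_on UNIV (\<lambda>a a'. (if a = a' then 1 else 0) - (\<Sum>c\<in>UNIV. cnj (s c a) * s c a'))"
    using reduced_factorization[of w] by blast
  define X0 where "X0 p q = (\<Sum>c\<in>UNIV. cnj (s c (fst p)) * s c (fst q)) *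
    (\<Sum>c\<in>UNIV. cnj (r c (snd p)) * r c (snd q))" for p q
  have W: "(\<Sum>c\<in>UNIV. s c (fst p) * r c (snd p)) = w p" for p
    using sr[of "fst p" "snd p"] by simp
  have "isotropic_pair (real CARD('b)) X0 (\<lambda>p q. cnj (w p) * w q)"
    using isotropic_pair_of_factorization[of s r] unfolding W X0_def .
  moreover have "Re (pairing (choi_kernel P) X0) \<le> Re (pairing (choi_kernel P)
       (\<lambda>p q. (if fst p = fst q then 1 else 0) * (\<Sum>a\<in>UNIV. cnj (w (a, snd p)) * w (a, snd q))))"
  proof -
    have "psd_on UNIV (\<lambda>b b'. \<Sum>c\<in>UNIV. cnj (r c b) * r c b')"
      by (intro psd_on_sum psd_on_rank_one)
    from positive_map_pairing[OF assms(1) G this] show ?thesis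
      unfolding H by (simp add: X0_def[abs_def] left_diff_distrib pairing_diff complex_nonneg_Reals_iff)
  qed
  then have "c * Re (pairing (choi_kernel P)
       (\<lambda>p q. (if fst p = fst q then 1 else 0) * (\<Sum>a\<in>UNIV. cnj (w (a, snd p)) * w (a, snd q))))
       \<le> c * Re (pairing (choi_kernel P) X0)"
    using assms(4) by (rule mult_left_mono_neg)
  ultimately show ?thesis
    using w by (meson order_less_le_trans)
qed

section \<open>The product test\<close>

text \<open>Expanding the products, the sum keeps twice the terms with an even number of factors
  \<open>X1\<close> and the difference twice those with an odd number. Multiplication by
  \<open>X1\<close> changes the parity, so both claims share one induction.\<close>

lemma psd_prod_plus_minus:
  fixes X0 X1 :: "'k \<Rightarrow> 'i::finite \<Rightarrow> 'i \<Rightarrow> complex"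
  assumes "\<And>k. psd_on UNIV (X0 k)" "\<And>k. psd_on UNIV (X1 k)"
  shows "psd_on UNIV (\<lambda>p q. (\<Prod>k\<in>S. X0 k p q + X1 k p q) + (\<Prod>k\<in>S. X0 k p q - X1 k p q))"
    and "psd_on UNIV (\<lambda>p q. (\<Prod>k\<in>S. X0 k p q + X1 k p q) - (\<Prod>k\<in>S. X0 k p q - X1 k p q))"
proof (induction S rule: infinite_finite_induct)
  case (insert x S)
  let ?v = "\<lambda>p q. \<Prod>k\<in>S. X0 k p q + X1 k p q" and ?u = "\<lambda>p q. \<Prod>k\<in>S. X0 k p q - X1 k p q"
  have "psd_on UNIV (\<lambda>p q. X0 x p q * (?v p q + ?u p q) + X1 x p q * (?v p q - ?u p q))"
    "psd_on UNIV (\<lambda>p q. X0 x p q * (?v p q - ?u p q) + X1 x p q * (?v p q + ?u p q))"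
    by (intro psd_on_add psd_on_mult finite assms insert.IH)+
  moreover have "(\<Prod>k\<in>insert x S. X0 k p q + X1 k p q) + (\<Prod>k\<in>insert x S. X0 k p q - X1 k p q) =
      X0 x p q * (?v p q + ?u p q) + X1 x p q * (?v p q - ?u p q)"
    "(\<Prod>k\<in>insert x S. X0 k p q + X1 k p q) - (\<Prod>k\<in>insert x S. X0 k p q - X1 k p q) =
      X0 x p q * (?v p q - ?u p q) + X1 x p q * (?v p q + ?u p q)" for p q
    using insert.hyps by (simp_all add: algebra_simps)
  ultimately show "psd_on UNIV (\<lambda>p q. (\<Prod>k\<in>insert x S. X0 k p q + X1 k p q) + (\<Prod>k\<in>insert x S. X0 k p q - X1 k p q))"
    "psd_on UNIV (\<lambda>p q. (\<Prod>k\<in>insert x S. X0 k p q + X1 k p q) - (\<Prod>k\<in>insert x S. X0 k p q - X1 k p q))"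
    by presburger+
\<comment> \<open>Empty products, and by convention infinite ones, are 1; the kernels are then the
  constants 2 and 0.\<close>
qed (use psd_on_rank_one[of UNIV "\<lambda>_. 0"] psd_on_scale[OF psd_on_rank_one[of UNIV "\<lambda>_. 1"], of 2] in simp_all)

text \<open>
  With \<open>E = X1 / \<delta>\<close> and \<open>Z = X0 - E\<close> the two products have factors \<open>Z - (\<delta> - 1) E\<close> and
  \<open>Z + (\<delta> + 1) E\<close>, and the constant \<open>(\<delta> - 1) / (\<delta> + 1)\<close> makes the coefficient of \<open>E\<close> in the
  induction step a multiple of the second kernel of \<open>psd_prod_plus_minus\<close>.
\<close>
lemma psd_prod_weighted:
  fixes X0 X1 :: "'k \<Rightarrow> 'i::finite \<Rightarrow> 'i \<Rightarrow> complex" and \<delta> :: real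
  assumes X: "\<And>k. psd_on UNIV (X0 k)" "\<And>k. psd_on UNIV (X1 k)"
    and dX: "\<And>k. psd_on UNIV (\<lambda>p q. complex_of_real \<delta> * X0 k p q - X1 k p q)" and \<delta>: "1 \<le> \<delta>"
  defines "\<kappa> \<equiv> (\<delta> - 1) / (\<delta> + 1)"
  shows "psd_on UNIV (\<lambda>p q. (\<Prod>k\<in>S. X0 k p q - X1 k p q) +
    complex_of_real \<kappa> * (\<Prod>k\<in>S. X0 k p q + X1 k p q))"
proof (induction S rule: infinite_finite_induct)
  case (insert x S)
  let ?v = "\<lambda>p q. \<Prod>k\<in>S. X0 k p q + X1 k p q" and ?u = "\<lambda>p q. \<Prod>k\<in>S. X0 k p q - X1 k p q"
  let ?Z = "\<lambda>p q. complex_of_real (1 / \<delta>) * (complex_of_real \<delta> * X0 x p q - X1 x p q)"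
  have \<kappa>: "complex_of_real \<delta> * complex_of_real \<kappa> = complex_of_real \<delta> - 1 - complex_of_real \<kappa>"
  proof -
    have "\<delta> * \<kappa> = \<delta> - 1 - \<kappa>"
      using \<delta> by (simp add: \<kappa>_def field_simps)
    then show ?thesis by (metis of_real_1 of_real_diff of_real_mult)
  qed
  have "psd_on UNIV (\<lambda>p q. ?Z p q * (?u p q + complex_of_real \<kappa> * ?v p q) +
      complex_of_real ((\<delta> - 1) / \<delta>) * (X1 x p q * (?v p q - ?u p q)))"
    using \<delta> by (intro psd_on_add psd_on_mult psd_on_scale finite assms insert.IH psd_prod_plus_minus(2)) simp_all
  moreover have "(\<Prod>k\<in>insert x S. X0 k p q - X1 k p q) + complex_of_real \<kappa> * (\<Prod>k\<in>insert x S. X0 k p q + X1 k p q) =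
      ?Z p q * (?u p q + complex_of_real \<kappa> * ?v p q) +
      complex_of_real ((\<delta> - 1) / \<delta>) * (X1 x p q * (?v p q - ?u p q))" for p q
  proof -
    define e where "e = complex_of_real (1 / \<delta>) * X1 x p q"
    have e: "X1 x p q = complex_of_real \<delta> * e"
      using \<delta> by (simp add: e_def)
    have Z: "?Z p q = X0 x p q - e"
      using \<delta> by (simp add: e field_simps)
    have E: "complex_of_real ((\<delta> - 1) / \<delta>) * (X1 x p q * y) = (complex_of_real \<delta> - 1) * e * y" for y
      using \<delta> by (simp add: e)
    have "(X0 x p q - complex_of_real \<delta> * e) * u + complex_of_real \<kappa> * ((X0 x p q + complex_of_real \<delta> * e) * v) =
        (X0 x p q - e) * (u + complex_of_real \<kappa> * v) + (complex_of_real \<delta> - 1) * e * (v - u)" for u v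
      using \<kappa> by algebra
    then show ?thesis
      unfolding Z E using insert.hyps by (simp add: e)
  qed
  ultimately show ?case by presburger
next
  case empty
  have "0 \<le> 1 + \<kappa>"
    using \<delta> by (simp add: \<kappa>_def)
  from psd_on_scale[OF psd_on_rank_one[of UNIV "\<lambda>_. 1"] this] show ?case
    by simp
next
  case (infinite S)
  have "0 \<le> 1 + \<kappa>"
    using \<delta> by (simp add: \<kappa>_def)
  from psd_on_scale[OF psd_on_rank_one[of UNIV "\<lambda>_. 1"] this] infinite show ?case
    by simp
qed

section \<open>Kernels assembled from two groups of sites and a filler\<close>

lemma psd_coordinate:
  fixes K :: "'i::finite \<Rightarrow> 'i \<Rightarrow> complex" and k :: "'n::finite"
  assumes "psd_on UNIV K"
  shows "psd_on UNIV (\<lambda>p q. K (p k) (q k))"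
  by (rule psd_on_pullback[OF assms]) auto

definition site_kernel :: "'n set \<Rightarrow> 'n set \<Rightarrow> ('i \<Rightarrow> 'i \<Rightarrow> complex) \<Rightarrow> ('i \<Rightarrow> 'i \<Rightarrow> complex) \<Rightarrow>
    ('i \<Rightarrow> 'i \<Rightarrow> complex) \<Rightarrow> ('n::finite \<Rightarrow> 'i) \<Rightarrow> ('n \<Rightarrow> 'i) \<Rightarrow> complex" where
  "site_kernel I J R F G = tensor_kernel (\<lambda>k. if k \<in> I then F else if k \<in> J then G else R)"

lemma prod_site_split:
  assumes "I \<inter> J = {}"
  shows "(\<Prod>k\<in>(UNIV :: 'n::finite set). if k \<in> I then f k else if k \<in> J then g k else h k) =
    (\<Prod>k\<in>I. f k) * (\<Prod>k\<in>J. g k) * (\<Prod>k\<in>- (I \<union> J). h k)"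
proof -
  let ?t = "\<lambda>k. if k \<in> I then f k else if k \<in> J then g k else h k"
  have "prod ?t UNIV = prod ?t (I \<union> J) * prod ?t (- (I \<union> J))"
    unfolding Compl_partition[of "I \<union> J", symmetric] by (rule prod.union_disjoint) auto
  also have "prod ?t (I \<union> J) = prod ?t I * prod ?t J"
    using assms by (intro prod.union_disjoint) auto
  also have "prod ?t I = prod f I" by (intro prod.cong) auto
  also have "prod ?t J = prod g J" using assms by (intro prod.cong) auto
  also have "prod ?t (- (I \<union> J)) = prod h (- (I \<union> J))" by (intro prod.cong) auto
  finally show ?thesis .
qed

lemma site_kernel_eq:
  assumes "I \<inter> J = {}"
  shows "site_kernel I J R F G p q = (\<Prod>k\<in>I. F (p k) (q k)) * (\<Prod>k\<in>J. G (p k) (q k)) *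
    (\<Prod>k\<in>- (I \<union> J). R (p k) (q k))"
proof -
  have "site_kernel I J R F G p q = (\<Prod>k\<in>UNIV. if k \<in> I then F (p k) (q k) else if k \<in> J then G (p k) (q k) else R (p k) (q k))"
    unfolding site_kernel_def tensor_kernel_def by (intro prod.cong) auto
  then show ?thesis
    using prod_site_split[OF assms] by simp
qed

lemma site_kernel_commute:
  "I \<inter> J = {} \<Longrightarrow> site_kernel I J R F G = site_kernel J I R G F"
  by (auto simp: fun_eq_iff site_kernel_eq Int_commute Un_commute mult_ac)

lemma pairing_site_kernel:
  fixes C :: "'i::finite \<Rightarrow> 'i \<Rightarrow> complex"
  assumes "I \<inter> J = {}"
  shows "pairing (tensor_kernel (\<lambda>_. C)) (site_kernel I J R F G) =
    pairing C F ^ card I * pairing C G ^ card J * pairing C R ^ card (- (I \<union> J))"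
proof -
  have "pairing (tensor_kernel (\<lambda>_. C)) (site_kernel I J R F G) =
      (\<Prod>k\<in>UNIV. pairing C (if k \<in> I then F else if k \<in> J then G else R))"
    unfolding site_kernel_def tensor_kernel_def by (rule pairing_tensor)
  also have "\<dots> = (\<Prod>k\<in>UNIV. if k \<in> I then pairing C F else if k \<in> J then pairing C G else pairing C R)"
    by (intro prod.cong) auto
  finally show ?thesis
    by (simp add: prod_site_split[OF assms])
qed

lemma partial_transpose_site_kernel:
  "tensor_partial_transpose (site_kernel I J R F G) =
    site_kernel I J (partial_transpose R) (partial_transpose F) (partial_transpose G)"
  unfolding site_kernel_def tensor_partial_transpose_tensor_kernel
  by (intro arg_cong[where f = tensor_kernel]) auto

definition test_kernel :: "complex \<Rightarrow> 'n set \<Rightarrow> 'n set \<Rightarrow> ('i \<Rightarrow> 'i \<Rightarrow> complex) \<Rightarrow> ('i \<Rightarrow> 'i \<Rightarrow> complex) \<Rightarrow>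
    ('i \<Rightarrow> 'i \<Rightarrow> complex) \<Rightarrow> ('i \<Rightarrow> 'i \<Rightarrow> complex) \<Rightarrow> ('i \<Rightarrow> 'i \<Rightarrow> complex) \<Rightarrow> ('n::finite \<Rightarrow> 'i) \<Rightarrow> ('n \<Rightarrow> 'i) \<Rightarrow> complex" where
  "test_kernel \<kappa> I J R F F' G G' = (\<lambda>p q. site_kernel I J R F' G p q + site_kernel I J R F G' p q
     - site_kernel I J R F G p q + \<kappa> * site_kernel I J R F' G' p q)"

lemma test_kernel_commute:
  assumes "I \<inter> J = {}"
  shows "test_kernel \<kappa> I J R F F' G G' = test_kernel \<kappa> J I R G G' F F'"
  unfolding test_kernel_def site_kernel_commute[OF assms] by (simp add: add.commute)

lemma partial_transpose_test_kernel:
  "tensor_partial_transpose (test_kernel \<kappa> I J R F F' G G') =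
    test_kernel \<kappa> I J (partial_transpose R) (partial_transpose F) (partial_transpose F')
      (partial_transpose G) (partial_transpose G')"
  unfolding test_kernel_def partial_transpose_site_kernel[symmetric]
  by (simp add: tensor_partial_transpose_def fun_eq_iff)

text \<open>In the products over the groups, the kernel is
  \<open>u' (v - u) + v' (u + \<kappa> v)\<close> times the filler. The product lemmas make the
  brackets positive semidefinite; \<open>u'\<close> and \<open>v'\<close> are so by the conditions
  on partial transposes. Schur products combine them.\<close>

lemma psd_test_kernel:
  fixes X0 X1 :: "'a::finite \<times> 'b::finite \<Rightarrow> 'a \<times> 'b \<Rightarrow> complex" and I J :: "'n::finite set"
  assumes IJ: "I \<inter> J = {}" and X: "isotropic_pair \<delta> X0 X1" and Y: "isotropic_pair \<delta> Y0 Y1"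
    and R: "psd_on UNIV R" and \<delta>: "1 \<le> \<delta>"
  shows "psd_on UNIV (test_kernel (complex_of_real ((\<delta> - 1) / (\<delta> + 1))) I J R
    (\<lambda>p q. X0 p q - X1 p q) (\<lambda>p q. X0 p q + X1 p q)
    (partial_transpose (\<lambda>p q. Y0 p q - Y1 p q)) (partial_transpose (\<lambda>p q. Y0 p q + Y1 p q)))"
    (is "psd_on UNIV (test_kernel ?\<kappa> I J R _ _ ?Y ?Y')")
proof -
  let ?u = "\<lambda>p q. \<Prod>k\<in>I. X0 (p k) (q k) - X1 (p k) (q k)"
  let ?v = "\<lambda>p q. \<Prod>k\<in>I. X0 (p k) (q k) + X1 (p k) (q k)"
  let ?uJ = "\<lambda>p q. \<Prod>k\<in>J. ?Y (p k) (q k)"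
  let ?vJ = "\<lambda>p q. \<Prod>k\<in>J. ?Y' (p k) (q k)"
  let ?r = "\<lambda>p q. \<Prod>k\<in>- (I \<union> J). R (p k) (q k)"
  note iso = X[unfolded isotropic_pair_def] Y[unfolded isotropic_pair_def]
  have vu: "psd_on UNIV (\<lambda>p q. ?v p q - ?u p q)"
    by (rule psd_prod_plus_minus(2)[where ?X0.0 = "\<lambda>k p q. X0 (p k) (q k)" and ?X1.0 = "\<lambda>k p q. X1 (p k) (q k)"])
      (use iso in \<open>auto intro: psd_coordinate\<close>)
  have uv: "psd_on UNIV (\<lambda>p q. ?u p q + ?\<kappa> * ?v p q)"
  proof (rule psd_prod_weighted[where ?X0.0 = "\<lambda>k p q. X0 (p k) (q k)" and ?X1.0 = "\<lambda>k p q. X1 (p k) (q k)"])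
    show "psd_on UNIV (\<lambda>p q. complex_of_real \<delta> * X0 (p k) (q k) - X1 (p k) (q k))" for k :: 'n
      using iso by (intro psd_coordinate[where K = "\<lambda>x y. complex_of_real \<delta> * X0 x y - X1 x y"]) auto
  qed (use iso \<delta> in \<open>auto intro: psd_coordinate\<close>)
  have J: "psd_on UNIV ?uJ" "psd_on UNIV ?vJ" "psd_on UNIV ?r"
    by (intro psd_on_prod psd_coordinate finite; use iso R in blast)+
  have "psd_on UNIV (\<lambda>p q. (?uJ p q * (?v p q - ?u p q) + ?vJ p q * (?u p q + ?\<kappa> * ?v p q)) * ?r p q)"
    by (rule psd_on_mult[OF finite psd_on_add[OF psd_on_mult[OF finite J(1) vu] psd_on_mult[OF finite J(2) uv]] J(3)])
  moreover have "test_kernel ?\<kappa> I J R (\<lambda>p q. X0 p q - X1 p q) (\<lambda>p q. X0 p q + X1 p q) ?Y ?Y' =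
      (\<lambda>p q. (?uJ p q * (?v p q - ?u p q) + ?vJ p q * (?u p q + ?\<kappa> * ?v p q)) * ?r p q)"
    unfolding test_kernel_def site_kernel_eq[OF IJ] by (intro ext) algebra
  ultimately show ?thesis by simp
qed

section \<open>Filler sites and single-site tests\<close>

definition point_kernel :: "'i \<Rightarrow> 'i \<Rightarrow> 'i \<Rightarrow> complex" where
  "point_kernel x p q = (if p = x \<and> q = x then 1 else 0)"

lemma psd_point_kernel: "psd_on I (point_kernel x)"
proof -
  have "point_kernel x = (\<lambda>p q. cnj (if p = x then 1 else 0) * (if q = x then 1 else 0))"
    by (auto simp: point_kernel_def fun_eq_iff)
  then show ?thesis
    by (simp only: psd_on_rank_one)
qed

lemma partial_transpose_point_kernel: "partial_transpose (point_kernel x) = point_kernel x"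
  by (auto simp: partial_transpose_def point_kernel_def fun_eq_iff prod_eq_iff)

lemma pairing_point_kernel: "pairing C (point_kernel x) = C x (x :: 'i::finite)"
proof -
  have "C p q * point_kernel x p q = (if p = x then if q = x then C x x else 0 else 0)" for p q
    by (auto simp: point_kernel_def)
  moreover have "(\<Sum>q\<in>UNIV. if p = x then if q = x then C x x else 0 else 0) = (if p = x then C x x else 0)" for p
    by (cases "p = x") simp_all
  ultimately show ?thesis
    by (simp add: pairing_def)
qed

lemma psd_site_kernel:
  fixes F :: "'i::finite \<Rightarrow> 'i \<Rightarrow> complex"
  assumes "psd_on UNIV F" "psd_on UNIV G" "psd_on UNIV R"
  shows "psd_on UNIV (site_kernel I J R F G)"
  unfolding site_kernel_def tensor_kernel_def
  using assms by (intro psd_on_prod finite psd_coordinate) auto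

text \<open>One site carries \<open>F\<close> and the others the projector at \<open>x\<close>. That
  projector is its own partial transpose and contributes only a positive power of \<rho>.\<close>

lemma decomposable_site_nonneg:
  fixes P :: "complex^'a^'a::finite \<Rightarrow> complex^'b^'b::finite"
  assumes dec: "decomposable (tensor_power P ::
           complex^('n::finite \<Rightarrow> 'a)^('n \<Rightarrow> 'a) \<Rightarrow> complex^('n \<Rightarrow> 'b)^('n \<Rightarrow> 'b))"
    and x: "choi_kernel P x x = complex_of_real \<rho>" "0 < \<rho>"
    and F: "psd_on UNIV F" "psd_on UNIV (partial_transpose F)"
  shows "0 \<le> Re (pairing (choi_kernel P) F)"
proof -
  fix k :: 'n
  let ?W = "site_kernel {k} {} (point_kernel x) F F"
  have "pairing (tensor_kernel (\<lambda>_. choi_kernel P)) ?W \<in> \<real>\<^sub>\<ge>\<^sub>0"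
    by (rule decomposable_tensor_power_pairing[OF dec])
      (simp_all add: partial_transpose_site_kernel partial_transpose_point_kernel psd_site_kernel psd_point_kernel F)
  moreover have "pairing (tensor_kernel (\<lambda>_. choi_kernel P)) ?W =
      complex_of_real (\<rho> ^ card (- {k})) * pairing (choi_kernel P) F"
    by (simp add: pairing_site_kernel pairing_point_kernel x)
  ultimately have "0 \<le> \<rho> ^ card (- {k}) * Re (pairing (choi_kernel P) F)"
    by (simp add: complex_nonneg_Reals_iff del: of_real_power)
  then show ?thesis
    using x(2) by (metis zero_le_mult_iff zero_less_power not_le)
qed

section \<open>The numerical contradiction\<close>

lemma isotropic_pair_pairing_real:
  assumes "positive_map P" "isotropic_pair \<delta> X0 X1"
  shows "pairing (choi_kernel P) X0 \<in> \<real>" "pairing (choi_kernel P) X1 \<in> \<real>"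
  using assms pairing_hermitian_real[OF positive_map_choi_hermitian[OF assms(1)]]
  by (auto simp: isotropic_pair_def)

text \<open>The constant \<open>2 / (1 + x) - 1\<close> is \<open>(1 - x) / (1 + x)\<close>;
  clearing the denominator turns a bound on N / D into one comparing D - N with D + N.\<close>

lemma ratio_bound:
  fixes D N x :: real
  assumes "N < (2 / (1 + x) - 1) * D" "0 < 1 + x"
  shows "x * (D + N) < D - N"
proof -
  have "(1 + x) * N < (1 + x) * ((2 / (1 + x) - 1) * D)"
    using assms by (intro mult_strict_left_mono)
  also have "(1 + x) * ((2 / (1 + x) - 1) * D) = (1 - x) * D"
    using assms(2) by (simp add: field_simps)
  finally show ?thesis
    by (simp add: algebra_simps)
qed

lemma decomposable_ratio_contradiction:
  fixes P :: "complex^'a^'a::finite \<Rightarrow> complex^'b^'b::finite" and \<delta> x :: real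
  assumes P: "positive_map P" "P \<noteq> (\<lambda>X. 0)" "positive_map (transpose \<circ> P)"
    and dec: "decomposable (tensor_power P ::
           complex^('n::finite \<Rightarrow> 'a)^('n \<Rightarrow> 'a) \<Rightarrow> complex^('n \<Rightarrow> 'b)^('n \<Rightarrow> 'b))"
    and m: "0 < m" "2 * m \<le> CARD('n)"
    and x: "0 < x" "x ^ m = 1 + sqrt (2 * \<delta> / (\<delta> + 1))" and \<delta>: "1 \<le> \<delta>"
    and X: "isotropic_pair \<delta> X0 X1"
      "Re (pairing (choi_kernel P) X1) < (2 / (1 + x) - 1) * Re (pairing (choi_kernel P) X0)"
    and Y: "isotropic_pair \<delta> Y0 Y1"
      "Re (pairing (choi_kernel (transpose \<circ> P)) Y1) < (2 / (1 + x) - 1) * Re (pairing (choi_kernel (transpose \<circ> P)) Y0)"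
  shows False
proof -
  let ?C = "choi_kernel P"
  let ?R = "point_kernel :: 'a \<times> 'b \<Rightarrow> _"
  obtain z where z: "0 < Re (?C z z)"
    using positive_map_choi_diag[OF P(1,2)] by blast
  define \<rho> where "\<rho> = Re (?C z z)"
  have "?C z z \<in> \<real>"
    using pairing_hermitian_real[OF positive_map_choi_hermitian[OF P(1)] psd_point_kernel[of UNIV z]]
    by (simp add: pairing_point_kernel)
  then have \<rho>: "?C z z = complex_of_real \<rho>" "0 < \<rho>"
    using z by (simp_all add: \<rho>_def)
  \<comment> \<open>Since \<open>2 * m \<le> CARD('n)\<close>, two disjoint groups of
    \<open>m\<close> sites fit; the sites left over carry the filler at \<open>z\<close>.\<close>
  obtain I :: "'n set" where I: "card I = m"
    using obtain_subset_with_card_n[of m "UNIV :: 'n set"] m by auto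
  have "m \<le> card (- I)"
    using m I by (simp add: Compl_eq_Diff_UNIV card_Diff_subset)
  then obtain J where J: "J \<subseteq> - I" "card J = m"
    by (rule obtain_subset_with_card_n)
  have IJ: "I \<inter> J = {}" "J \<inter> I = {}"
    using J by auto
  define D1 N1 D2 N2 where "D1 = Re (pairing ?C X0)" and "N1 = Re (pairing ?C X1)"
    and "D2 = Re (pairing ?C (partial_transpose Y0))" and "N2 = Re (pairing ?C (partial_transpose Y1))"
  have C1: "pairing ?C X0 = complex_of_real D1" "pairing ?C X1 = complex_of_real N1"
    using isotropic_pair_pairing_real[OF P(1) X(1)] by (simp_all add: D1_def N1_def)
  have C2: "pairing ?C (partial_transpose Y0) = complex_of_real D2"
    "pairing ?C (partial_transpose Y1) = complex_of_real N2"
    using isotropic_pair_pairing_real[OF P(3) Y(1)]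
    by (simp_all add: D2_def N2_def choi_kernel_transpose flip: pairing_partial_transpose)
  let ?A = "\<lambda>p q. X0 p q - X1 p q" and ?A' = "\<lambda>p q. X0 p q + X1 p q"
  let ?B = "partial_transpose (\<lambda>p q. Y0 p q - Y1 p q)" and ?B' = "partial_transpose (\<lambda>p q. Y0 p q + Y1 p q)"
  have pt: "?B = (\<lambda>p q. partial_transpose Y0 p q - partial_transpose Y1 p q)"
    "?B' = (\<lambda>p q. partial_transpose Y0 p q + partial_transpose Y1 p q)"
    by (simp_all add: partial_transpose_def fun_eq_iff)
  have vals: "pairing ?C ?A = complex_of_real (D1 - N1)" "pairing ?C ?A' = complex_of_real (D1 + N1)"
    "pairing ?C ?B = complex_of_real (D2 - N2)" "pairing ?C ?B' = complex_of_real (D2 + N2)"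
    unfolding pt by (simp_all add: pairing_add pairing_diff C1 C2)
  \<comment> \<open>\<open>X0 + X1\<close> and its partial transpose are both positive semidefinite,
    so one site alone forces the sign. Monotonicity of \<open>m\<close>-th powers will need
    it.\<close>
  have "0 \<le> Re (pairing ?C ?A')"
    by (rule decomposable_site_nonneg[OF dec \<rho>])
      (use X(1) in \<open>auto simp: isotropic_pair_def intro: psd_on_add\<close>)
  then have V1: "0 \<le> D1 + N1" by (simp add: vals)
  have "0 \<le> Re (pairing ?C ?B')"
    by (rule decomposable_site_nonneg[OF dec \<rho>])
      (use Y(1) in \<open>auto simp: isotropic_pair_def intro: psd_on_add\<close>)
  then have V2: "0 \<le> D2 + N2" by (simp add: vals)
  define \<kappa> where "\<kappa> = (\<delta> - 1) / (\<delta> + 1)"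
  let ?W = "test_kernel (complex_of_real \<kappa>) I J (?R z) ?A ?A' ?B ?B'"
  have "psd_on UNIV ?W"
    unfolding \<kappa>_def by (rule psd_test_kernel[OF IJ(1) X(1) Y(1) psd_point_kernel \<delta>])
  \<comment> \<open>Partial transposition restores the kernels \<open>Y\<close> and transposes the
    kernels \<open>X\<close>; after commuting the groups, this is the same claim with
    \<open>I\<close>, \<open>X\<close> and \<open>J\<close>, \<open>Y\<close> exchanged.\<close>
  moreover have "psd_on UNIV (tensor_partial_transpose ?W)"
    unfolding \<kappa>_def partial_transpose_test_kernel partial_transpose_point_kernel
      partial_transpose_involution test_kernel_commute[OF IJ(1)]
    by (rule psd_test_kernel[OF IJ(2) Y(1) X(1) psd_point_kernel \<delta>])
  ultimately have "pairing (tensor_kernel (\<lambda>_. ?C)) ?W \<in> \<real>\<^sub>\<ge>\<^sub>0"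
    by (rule decomposable_tensor_power_pairing[OF dec])
  define U V U' V' where "U = (D1 - N1) ^ m" and "V = (D1 + N1) ^ m"
    and "U' = (D2 - N2) ^ m" and "V' = (D2 + N2) ^ m"
  have "pairing (tensor_kernel (\<lambda>_. ?C)) ?W =
      complex_of_real ((V * U' + U * V' - U * U' + \<kappa> * (V * V')) * \<rho> ^ card (- (I \<union> J)))"
    unfolding test_kernel_def pairing_add pairing_diff pairing_scale pairing_site_kernel[OF IJ(1)] vals
      pairing_point_kernel \<rho>(1) I J(2) U_def V_def U'_def V'_def
    by (simp add: C1 algebra_simps)
  with \<open>pairing (tensor_kernel (\<lambda>_. ?C)) ?W \<in> \<real>\<^sub>\<ge>\<^sub>0\<close>
  have "0 \<le> (V * U' + U * V' - U * U' + \<kappa> * (V * V')) * \<rho> ^ card (- (I \<union> J))"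
    by (metis Re_complex_of_real complex_nonneg_Reals_iff)
  then have nonneg: "0 \<le> V * U' + U * V' - U * U' + \<kappa> * (V * V')"
    using \<rho>(2) by (metis zero_le_mult_iff zero_less_power not_le)
  \<comment> \<open>\<sigma> is the square root of 1 + \<kappa>, and the choice of \<open>x\<close>
    gives \<open>x ^ m = 1 + \<sigma>\<close>.\<close>
  define \<sigma> where "\<sigma> = sqrt (2 * \<delta> / (\<delta> + 1))"
  have \<sigma>: "0 \<le> \<sigma>" "\<sigma> * \<sigma> = 1 + \<kappa>"
    using \<delta> by (simp_all add: \<sigma>_def \<kappa>_def field_simps)
  have gap: "\<sigma> * v ^ m < u ^ m - v ^ m" if "x * v < u" "0 \<le> v" for u v
  proof -
    have "(x * v) ^ m < u ^ m"
      using that x m by (intro power_strict_mono) auto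
    then show ?thesis
      using x(2) by (simp add: power_mult_distrib \<sigma>_def algebra_simps)
  qed
  have "x * (D1 + N1) < D1 - N1"
    using X(2) x(1) by (intro ratio_bound) (simp_all add: D1_def N1_def)
  from gap[OF this V1] have g1: "\<sigma> * V < U - V" by (simp add: U_def V_def)
  have "x * (D2 + N2) < D2 - N2"
    using Y(2) x(1) by (intro ratio_bound)
      (simp_all add: D2_def N2_def choi_kernel_transpose flip: pairing_partial_transpose)
  from gap[OF this V2] have g2: "\<sigma> * V' < U' - V'" by (simp add: U'_def V'_def)
  have "0 \<le> \<sigma> * V" "0 \<le> \<sigma> * V'"
    using \<sigma> V1 V2 by (simp_all add: V_def V'_def)
  then have "(\<sigma> * V) * (\<sigma> * V') < (U - V) * (U' - V')"
    using g1 g2 by (intro mult_strict_mono) auto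
  moreover have "(\<sigma> * V) * (\<sigma> * V') = (1 + \<kappa>) * (V * V')"
    unfolding \<sigma>(2)[symmetric] by algebra
  ultimately show False
    using nonneg by (simp add: algebra_simps)
qed

section \<open>Composition with the transposition, and the conclusion\<close>

lemma psd_transpose:
  assumes "psd A"
  shows "psd (transpose A)"
  unfolding psd_def psd_on_def
proof
  fix v
  \<comment> \<open>The form of the transpose at \<open>v\<close> is that of \<open>A\<close> at the
    conjugate of \<open>v\<close>.\<close>
  have "(\<Sum>i\<in>UNIV. \<Sum>j\<in>UNIV. cnj (v i) * transpose A $ i $ j * v j) =
      (\<Sum>j\<in>UNIV. \<Sum>i\<in>UNIV. cnj (cnj (v j)) * A $ j $ i * cnj (v i))"
    by (subst sum.swap) (simp add: transpose_def mult_ac)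
  also have "\<dots> \<in> \<real>\<^sub>\<ge>\<^sub>0"
    using assms unfolding psd_def psd_on_def by (rule spec)
  finally show "(\<Sum>i\<in>UNIV. \<Sum>j\<in>UNIV. cnj (v i) * transpose A $ i $ j * v j) \<in> \<real>\<^sub>\<ge>\<^sub>0" .
qed

lemma positive_map_transpose:
  assumes "positive_map P"
  shows "positive_map (transpose \<circ> P)"
  using assms
  by (simp add: positive_map_def clinear_map_iff psd_transpose)
    (simp add: transpose_def mat_scale_def vec_eq_iff)

theorem theorem1p2:
  fixes P :: "complex^'a^'a::finite \<Rightarrow> complex^'b^'b::finite"
    and d n :: nat
  assumes "positive_map P"
    and "P \<noteq> (\<lambda>X. 0)"
    and "d = min CARD('a) CARD('b)"
    and "n = CARD('n::finite)"
    and "n \<ge> 2"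
    and "decomposable (tensor_power P ::
           complex^('n \<Rightarrow> 'a)^('n \<Rightarrow> 'a) \<Rightarrow> complex^('n \<Rightarrow> 'b)^('n \<Rightarrow> 'b))"
  shows "max (mu P) (mu (transpose \<circ> P)) \<ge>
           2 / (1 + (1 + sqrt (2 * real d / (real d + 1))) powr (1 / real_of_int \<lfloor>real n / 2\<rfloor>)) - 1"
proof (rule ccontr)
  define m where "m = n div 2"
  define x where "x = (1 + sqrt (2 * real d / (real d + 1))) powr (1 / real m)"
  define c where "c = 2 / (1 + x) - 1"
  assume "\<not> ?thesis"
  moreover have "real_of_int \<lfloor>real n / 2\<rfloor> = real m"
    using floor_divide_of_nat_eq[of n 2, where 'a = real] by (simp add: m_def)
  ultimately have less: "mu P < c" "mu (transpose \<circ> P) < c"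
    by (auto simp: c_def x_def)
  have m: "0 < m" "2 * m \<le> CARD('n)"
    using assms(4,5) by (auto simp: m_def)
  have s: "0 \<le> sqrt (2 * real d / (real d + 1))" by simp
  have x1: "1 \<le> x"
    unfolding x_def using s by (intro ge_one_powr_ge_zero) auto
  have xm: "x ^ m = 1 + sqrt (2 * real d / (real d + 1))"
  proof -
    have "x ^ m = x powr real m"
      using x1 by (simp add: powr_realpow)
    then show ?thesis
      using m s by (simp add: x_def powr_powr)
  qed
  \<comment> \<open>Required for extracting test pairs from \<open>mu\<close>; it holds because the
    root \<open>x\<close> is at least 1.\<close>
  have c: "c \<le> 0"
    using x1 by (simp add: c_def)
  have P': "positive_map (transpose \<circ> P)"
    by (rule positive_map_transpose[OF assms(1)])
  have nz: "transpose \<circ> P \<noteq> (\<lambda>X. 0)"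
  proof
    assume "transpose \<circ> P = (\<lambda>X. 0)"
    then have "P X $ i $ j = 0" for X i j
    proof -
      have "transpose (P X) = 0"
        by (metis \<open>transpose \<circ> P = (\<lambda>X. 0)\<close> comp_apply)
      then show ?thesis
        by (simp add: transpose_def vec_eq_iff)
    qed
    then show False
      using assms(2) by (simp add: vec_eq_iff fun_eq_iff)
  qed
  have d: "1 \<le> real d"
    using assms(3) by (simp add: Suc_leI)
  \<comment> \<open>Expanding along the smaller of the two systems gives the parameter
    \<open>d\<close> in either case.\<close>
  have pair: "\<exists>X0 X1. isotropic_pair (real d) X0 X1 \<and>
      Re (pairing (choi_kernel Q) X1) < c * Re (pairing (choi_kernel Q) X0)"
    if "positive_map Q" "Q \<noteq> (\<lambda>X. 0)" "mu Q < c" for Q :: "complex^'a^'a \<Rightarrow> complex^'b^'b"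
    using mu_less_obtain_pair_left[OF that c] mu_less_obtain_pair_right[OF that c] assms(3)
    by (cases "CARD('a) \<le> CARD('b)") (simp_all add: min_def)
  obtain X0 X1 where X: "isotropic_pair (real d) X0 X1"
      "Re (pairing (choi_kernel P) X1) < c * Re (pairing (choi_kernel P) X0)"
    using pair[OF assms(1,2) less(1)] by blast
  obtain Y0 Y1 where Y: "isotropic_pair (real d) Y0 Y1"
      "Re (pairing (choi_kernel (transpose \<circ> P)) Y1) < c * Re (pairing (choi_kernel (transpose \<circ> P)) Y0)"
    using pair[OF P' nz less(2)] by blast
  show False
    using decomposable_ratio_contradiction[OF assms(1,2) P' assms(6) m _ xm d X(1) _ Y(1)] X(2) Y(2) x1
    by (simp add: c_def)
qed

end
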